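(* Let $\rho>2$ be a real number and $M$ an integer. Let $\Phi_{M,\rho}$ be the set of elements $\alpha\in\mathcal{O}_\infty$ that can be written as $\alpha=\lim_{n\rightarrow\infty}\frac{f_n}{g_n}$ with $f_n,g_n\in A$, $g_n\neq0$, and $$\left|\alpha-\frac{f_n}{g_n}\right|_\infty<\frac{|\pi|_\infty^M}{|g_n|_\infty^\rho}\quad\text{for all } n.$$ Then $\Phi_{M,\rho}$ has Haar measure zero.
   Context: Let $\mathbb{F}=\mathbb{F}_q$ be a finite field and $X$ a smooth irreducible projective curve over $\mathbb{F}$ with function field $K$. Let $P_\infty$ be a closed point of $X$, $K_\infty$ the completion of $K$ at $P_\infty$, $\nu_\infty$ the normalized discrete valuation of $K_\infty$, $|x|_\infty=q^{-\nu_\infty(x)}$, $\mathcal{O}_\infty=\{x\in K_\infty:|x|_\infty\le 1\}$, and $\pi$ a fixed uniformizing parameter. Let $A$ be the ring of rational functions on $X$ that are regular at every closed point other than $P_\infty$. Haar measure refers to the additive Haar measure of $K_\infty$. *)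

theory Defs
  imports
    "HOL-Analysis.Analysis"
    "HOL-Library.Poly_Mapping"
    "HOL-Algebra.Algebraic_Closure_Type"
    "HOL-Algebra.Finite_Extensions"
    "HOL-Algebra.Generated_Fields"
    "Jordan_Normal_Form.Determinant"
begin

text \<open>
  Multivariate polynomials are finitely supported maps from monomials to coefficients, a monomial
  being a finitely supported map from variable indices to exponents.
\<close>

definition mpolys :: "'k::field set \<Rightarrow> nat \<Rightarrow> ((nat \<Rightarrow>\<^sub>0 nat) \<Rightarrow>\<^sub>0 'k) set" where
  "mpolys F n = {f. (\<forall>m. Poly_Mapping.lookup f m \<in> F) \<and>
                    (\<forall>m\<in>Poly_Mapping.keys f. Poly_Mapping.keys m \<subseteq> {..n})}"

definition mpoly_eval :: "(nat \<Rightarrow> 'k::field) \<Rightarrow> ((nat \<Rightarrow>\<^sub>0 nat) \<Rightarrow>\<^sub>0 'k) \<Rightarrow> 'k" where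
  "mpoly_eval y f = (\<Sum>m\<in>Poly_Mapping.keys f. Poly_Mapping.lookup f m *
     (\<Prod>j\<in>Poly_Mapping.keys m. y j ^ Poly_Mapping.lookup m j))"

definition mpoly_pderiv ::
    "nat \<Rightarrow> ((nat \<Rightarrow>\<^sub>0 nat) \<Rightarrow>\<^sub>0 'k::field) \<Rightarrow> ((nat \<Rightarrow>\<^sub>0 nat) \<Rightarrow>\<^sub>0 'k)" where
  "mpoly_pderiv j f = (\<Sum>m\<in>Poly_Mapping.keys f.
     Poly_Mapping.single (m - Poly_Mapping.single j 1)
       (of_nat (Poly_Mapping.lookup m j) * Poly_Mapping.lookup f m))"

text \<open>
  An integral projective variety \<open>X\<close> in projective \<open>n\<close>-space over \<open>F\<close>, with function field \<open>K\<close>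
  (the type \<open>'k\<close>), is given by its generic point \<open>(x 0 : \<dots> : x n)\<close> with coordinates in \<open>K\<close>: it is the
  closed subscheme cut out by the homogeneous prime ideal of all homogeneous polynomials over \<open>F\<close>
  vanishing at \<open>x\<close>. Thus \<open>X\<close> is covered by the affine charts \<open>Spec F[x 0 / x i, \<dots>, x n / x i]\<close> for
  \<open>x i \<noteq> 0\<close>, and \<open>K\<close> is generated over \<open>F\<close> by the quotients \<open>x j / x i\<close>.
\<close>

definition chart_coord :: "(nat \<Rightarrow> 'k::field) \<Rightarrow> nat \<Rightarrow> nat \<Rightarrow> 'k" where
  "chart_coord x i j = x j / x i"

definition chart_ring :: "'k::field set \<Rightarrow> nat \<Rightarrow> (nat \<Rightarrow> 'k) \<Rightarrow> nat \<Rightarrow> 'k set" where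
  "chart_ring F n x i = mpoly_eval (chart_coord x i) ` mpolys F n"

definition chart_points :: "'k::field set \<Rightarrow> nat \<Rightarrow> (nat \<Rightarrow> 'k) \<Rightarrow> nat \<Rightarrow> 'k set set" where
  "chart_points F n x i =
     {\<mm>. maximalideal \<mm> (ring_of_type_algebra\<lparr>carrier := chart_ring F n x i\<rparr>)}"

text \<open>
  As \<open>X\<close> is integral and separated, a point is determined by its local ring inside \<open>K\<close>. A closed point
  is represented by its local ring, which makes it independent of the chart containing it.
\<close>

definition closed_points :: "'k::field set \<Rightarrow> nat \<Rightarrow> (nat \<Rightarrow> 'k) \<Rightarrow> 'k set set" where
  "closed_points F n x =
     {{a / b | a b. a \<in> chart_ring F n x i \<and> b \<in> chart_ring F n x i \<and> b \<notin> \<mm>} | i \<mm>.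
        i \<le> n \<and> x i \<noteq> 0 \<and> \<mm> \<in> chart_points F n x i}"

text \<open>
  Jacobian criterion for smoothness over \<open>F\<close> of relative dimension 1 at the closed point \<open>\<mm>\<close> of the
  chart \<open>i\<close>. All of \<open>Y\<^sub>0, \<dots>, Y\<^sub>n\<close> are kept as variables, so the chart sits in affine \<open>(n+1)\<close>-space
  (\<open>Y\<^sub>i - 1\<close> is one of its equations) and the Jacobian matrix over the residue field must have rank
  \<open>(n + 1) - 1 = n\<close>. On a curve its rank never exceeds \<open>n\<close>, so this means that some \<open>n\<close>-by-\<open>n\<close> minor
  does not vanish at \<open>\<mm>\<close>.
\<close>

definition smooth_at :: "'k::field set \<Rightarrow> nat \<Rightarrow> (nat \<Rightarrow> 'k) \<Rightarrow> nat \<Rightarrow> 'k set \<Rightarrow> bool" where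
  "smooth_at F n x i \<mm> \<longleftrightarrow>
     (\<exists>g \<sigma>. (\<forall>a<n. g a \<in> mpolys F n \<and> mpoly_eval (chart_coord x i) (g a) = 0 \<and> \<sigma> a \<le> n) \<and>
        Determinant.det (Matrix.mat n n
          (\<lambda>(a, b). mpoly_eval (chart_coord x i) (mpoly_pderiv (\<sigma> b) (g a)))) \<notin> \<mm>)"

definition smooth_projective_curve :: "'k::field set \<Rightarrow> nat \<Rightarrow> (nat \<Rightarrow> 'k) \<Rightarrow> bool" where
  "smooth_projective_curve F n x \<longleftrightarrow>
     subfield F (ring_of_type_algebra :: 'k ring) \<and>
     (\<exists>i\<le>n. x i \<noteq> 0) \<and>
     generate_field (ring_of_type_algebra :: 'k ring)
       (F \<union> {x j / x i | i j. i \<le> n \<and> j \<le> n \<and> x i \<noteq> 0}) = UNIV \<and>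
     \<comment> \<open>dimension 1, i.e. transcendence degree 1\<close>
     (\<exists>t. ring.transcendental (ring_of_type_algebra :: 'k ring) F t \<and>
        (\<forall>y. \<not> ring.transcendental (ring_of_type_algebra :: 'k ring)
               (generate_field ring_of_type_algebra (F \<union> {t})) y)) \<and>
     (\<forall>i\<le>n. x i \<noteq> 0 \<longrightarrow> (\<forall>\<mm>\<in>chart_points F n x i. smooth_at F n x i \<mm>))"

definition regular_away_from :: "'k::field set \<Rightarrow> nat \<Rightarrow> (nat \<Rightarrow> 'k) \<Rightarrow> 'k set \<Rightarrow> 'k set" where
  "regular_away_from F n x P = {f. \<forall>Q\<in>closed_points F n x. Q \<noteq> P \<longrightarrow> f \<in> Q}"

text \<open>The value of \<open>\<nu>\<close> at 0 (which should be infinite) is irrelevant throughout.\<close>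

definition normalized_valuation :: "('c::field \<Rightarrow> int) \<Rightarrow> bool" where
  "normalized_valuation \<nu> \<longleftrightarrow>
     (\<forall>a b. a \<noteq> 0 \<longrightarrow> b \<noteq> 0 \<longrightarrow> \<nu> (a * b) = \<nu> a + \<nu> b) \<and>
     (\<forall>a b. a \<noteq> 0 \<longrightarrow> b \<noteq> 0 \<longrightarrow> a + b \<noteq> 0 \<longrightarrow> min (\<nu> a) (\<nu> b) \<le> \<nu> (a + b)) \<and>
     \<nu> ` (UNIV - {0}) = UNIV"

definition val_abs :: "nat \<Rightarrow> ('c::field \<Rightarrow> int) \<Rightarrow> 'c \<Rightarrow> real" where
  "val_abs q \<nu> a = (if a = 0 then 0 else real q powi (- \<nu> a))"

text \<open>
  The type \<open>'c\<close>, with the valuation \<open>\<nu>\<close> and the embedding \<open>\<iota>\<close> of \<open>K\<close>, is the completion of \<open>K\<close> at the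
  point with local ring \<open>P\<close>: its metric is the complete metric given by \<open>\<nu>\<close>, the image of \<open>K\<close> is dense,
  and \<open>P\<close> is the valuation ring of the restriction of \<open>\<nu>\<close> to \<open>K\<close>. As \<open>K\<close> is dense, that restriction
  still has all integers as values, so it is the normalized valuation of \<open>P\<close>.
\<close>

definition completion_at ::
    "nat \<Rightarrow> 'k::field set \<Rightarrow> ('k \<Rightarrow> 'c::{field, complete_space}) \<Rightarrow> ('c \<Rightarrow> int) \<Rightarrow> bool" where
  "completion_at q P \<iota> \<nu> \<longleftrightarrow>
     field_hom \<iota> \<and>
     normalized_valuation \<nu> \<and>
     (\<forall>a b. dist a b = val_abs q \<nu> (a - b)) \<and>
     closure (\<iota> ` UNIV) = UNIV \<and>
     P = {f. val_abs q \<nu> (\<iota> f) \<le> 1}"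

text \<open>
  Inner and outer regularity are not required: they are automatic for Borel measures finite on
  compact sets of a locally compact second countable space such as \<open>K\<^sub>\<infinity>\<close>.
\<close>

definition haar_measure :: "'a::{topological_space, ab_group_add} measure \<Rightarrow> bool" where
  "haar_measure \<mu> \<longleftrightarrow>
     sets \<mu> = sets borel \<and>
     emeasure \<mu> UNIV \<noteq> 0 \<and>
     (\<forall>C. compact C \<longrightarrow> emeasure \<mu> C < \<infinity>) \<and>
     (\<forall>a. \<forall>B\<in>sets \<mu>. emeasure \<mu> ((\<lambda>b. a + b) ` B) = emeasure \<mu> B)"

definition Phi_set ::
    "nat \<Rightarrow> 'k::field set \<Rightarrow> ('k \<Rightarrow> 'c::{field, complete_space}) \<Rightarrow> ('c \<Rightarrow> int) \<Rightarrow> 'c \<Rightarrow> int \<Rightarrow> real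
      \<Rightarrow> 'c set" where
  "Phi_set q A \<iota> \<nu> \<pi> M \<rho> =
     {\<alpha>. val_abs q \<nu> \<alpha> \<le> 1 \<and>
        (\<exists>f g. (\<forall>k::nat. f k \<in> A \<and> g k \<in> A \<and> g k \<noteq> 0) \<and>
           (\<lambda>k. \<iota> (f k) / \<iota> (g k)) \<longlonglongrightarrow> \<alpha> \<and>
           (\<forall>k. val_abs q \<nu> (\<alpha> - \<iota> (f k) / \<iota> (g k))
                  < val_abs q \<nu> \<pi> powi M / val_abs q \<nu> (\<iota> (g k)) powr \<rho>))}"

end

theory Submission
  imports Defs
begin

text \<open>
  The count \<open>|{a \<in> A. |a| \<le> q\<^sup>r}| \<le> Q\<^bsup>r+1\<^esup>\<close>, where \<open>Q\<close> is the size of the residue field of \<open>K\<^sub>\<infinity>\<close>, replaces the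
  theorem of Riemann-Roch. It needs only that \<open>0\<close> is the one element of \<open>A\<close> with \<open>|a| < 1\<close>: such an element
  is regular at every closed point, hence lies in every chart ring, hence multiplies the finite set of
  forms of some large degree into itself, hence is \<open>0\<close> or a root of unity. Finiteness of the residue
  field follows from transcendence degree 1: \<open>K\<close> is algebraic over a simple extension of \<open>F\<close>, on which the
  valuation is therefore nontrivial. The theorem is then the convergence part of the Borel-Cantelli
  lemma, as the fractions with denominator of absolute value \<open>q\<^sup>r\<close> contribute total measure of order
  \<open>Q\<^bsup>(2-\<rho>)r\<^esup>\<close>.
\<close>

section \<open>Localizations and chart rings\<close>

text \<open>Two sizes compete: absolute values are powers of \<open>q\<close>, the size of
  \<open>F\<close>, while indices of balls and hence Haar measures are powers of \<open>Q\<close>,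
  the size of the residue field, which is larger when the point at infinity has degree above one.
  The threshold \<open>\<rho> > 2\<close> is right all the same, since the number of fractions and
  the measure of the balls around them are both powers of \<open>Q\<close> in the valuation of the
  denominator. The completion is given only as a complete space. A Haar measure is finite on balls
  once these are known to be compact, which is why the residue field is shown to be finite before
  any measure is computed. Borel-Cantelli requires denominators of unbounded absolute value. An
  \<alpha> that is itself a fraction is approximated by a constant sequence, so the fractions are
  put aside as a countable null set. Any other \<alpha> keeps a positive distance from the finitely
  many fractions whose numerator and denominator stay below a given bound.\<close>

lemma type_algebra_simps [simp]:
  "carrier (ring_of_type_algebra :: 'k::field ring) = UNIV"
  "mult (ring_of_type_algebra :: 'k ring) = (*)"
  "one (ring_of_type_algebra :: 'k ring) = 1"
  "zero (ring_of_type_algebra :: 'k ring) = 0"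
  "add (ring_of_type_algebra :: 'k ring) = (+)"
  by (simp_all add: ring_of_type_algebra_def)

lemma type_algebra_a_inv [simp]:
  "a_inv (ring_of_type_algebra :: 'k::field ring) a = - a"
proof -
  interpret R: ring "ring_of_type_algebra :: 'k ring" by (rule ring_from_type_algebra)
  have "- a \<oplus>\<^bsub>ring_of_type_algebra\<^esub> a = \<zero>\<^bsub>ring_of_type_algebra\<^esub>" by simp
  then show ?thesis using R.minus_equality by force
qed

lemma type_algebra_m_inv [simp]:
  assumes "a \<noteq> (0 :: 'k::field)"
  shows "m_inv ring_of_type_algebra a = inverse a"
proof -
  interpret R: field "ring_of_type_algebra :: 'k ring" by (rule field_from_type_algebra)
  have "inverse a \<otimes>\<^bsub>ring_of_type_algebra\<^esub> a = \<one>\<^bsub>ring_of_type_algebra\<^esub>" using assms by simp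
  then show ?thesis using R.comm_inv_char[of a "inverse a"] assms by simp
qed

text \<open>Agrees with \<open>subring\<close> of the ambient field viewed as an algebraic
  structure; this form keeps computations in plain field arithmetic.\<close>

definition type_subring :: "'k::field set \<Rightarrow> bool" where
  "type_subring R \<longleftrightarrow> 1 \<in> R \<and> (\<forall>a\<in>R. \<forall>b\<in>R. a - b \<in> R \<and> a * b \<in> R)"

lemma type_subringD:
  assumes "type_subring R"
  shows "1 \<in> R" "0 \<in> R" "a \<in> R \<Longrightarrow> - a \<in> R" "a \<in> R \<Longrightarrow> b \<in> R \<Longrightarrow> a - b \<in> R"
    "a \<in> R \<Longrightarrow> b \<in> R \<Longrightarrow> a + b \<in> R" "a \<in> R \<Longrightarrow> b \<in> R \<Longrightarrow> a * b \<in> R"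
    "a \<in> R \<Longrightarrow> a ^ k \<in> R"
proof -
  show diff: "a - b \<in> R" if "a \<in> R" "b \<in> R" for a b
    using assms that unfolding type_subring_def by auto
  show "1 \<in> R" using assms unfolding type_subring_def by auto
  then show zero: "0 \<in> R" using diff[of 1 1] by simp
  show neg: "- a \<in> R" if "a \<in> R" for a using diff[OF zero that] by simp
  show "a + b \<in> R" if "a \<in> R" "b \<in> R" using diff[OF that(1) neg[OF that(2)]] by simp
  show mult: "a * b \<in> R" if "a \<in> R" "b \<in> R" for a b
    using assms that unfolding type_subring_def by auto
  show "a ^ k \<in> R" if "a \<in> R"
    by (induction k) (use that \<open>1 \<in> R\<close> mult in auto)
qed

lemma type_subring_sum:
  assumes "type_subring R" "\<And>i. i \<in> I \<Longrightarrow> h i \<in> R"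
  shows "sum h I \<in> R"
  using assms(2) by (induction I rule: infinite_finite_induct) (auto intro: type_subringD[OF assms(1)])

lemma subring_type_algebra_iff:
  "subring R (ring_of_type_algebra :: 'k::field ring) \<longleftrightarrow> type_subring R"
proof
  interpret K: ring "ring_of_type_algebra :: 'k ring" by (rule ring_from_type_algebra)
  assume R: "subring R (ring_of_type_algebra :: 'k ring)"
  show "type_subring R"
    unfolding type_subring_def
    using subringE(3)[OF R] subringE(5)[OF R] subringE(6)[OF R] subringE(7)[OF R]
    by (metis diff_conv_add_uminus type_algebra_simps(2,3,5) type_algebra_a_inv)
next
  interpret K: ring "ring_of_type_algebra :: 'k ring" by (rule ring_from_type_algebra)
  assume R: "type_subring R"
  show "subring R (ring_of_type_algebra :: 'k ring)"
    by (rule K.subringI) (use type_subringD[OF R] in auto)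
qed

lemma cring_restrict:
  assumes "type_subring R"
  shows "cring (ring_of_type_algebra\<lparr>carrier := R\<rparr>)"
proof -
  interpret K: cring "ring_of_type_algebra :: 'a ring" by (rule cring_from_type_algebra)
  have "subcring R (ring_of_type_algebra :: 'a ring)"
    by (rule K.subcringI') (use assms in \<open>simp add: subring_type_algebra_iff\<close>)
  then show ?thesis by (rule K.subcring_iff[THEN iffD1, rotated]) simp
qed

lemma restrict_a_inv:
  assumes "type_subring R" "a \<in> R"
  shows "a_inv (ring_of_type_algebra\<lparr>carrier := R\<rparr>) a = - a"
proof -
  interpret R: cring "ring_of_type_algebra\<lparr>carrier := R\<rparr>" by (rule cring_restrict[OF assms(1)])
  have "- a \<oplus>\<^bsub>ring_of_type_algebra\<lparr>carrier := R\<rparr>\<^esub> a = \<zero>\<^bsub>ring_of_type_algebra\<lparr>carrier := R\<rparr>\<^esub>" by simp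
  then show ?thesis using R.minus_equality type_subringD(3)[OF assms] assms by force
qed

text \<open>Closure under negatives follows from the last clause, as \<open>- a = (- 1) * a\<close>
  with \<open>- 1 \<in> R\<close>.\<close>

lemma ideal_restrict_iff:
  assumes R: "type_subring R"
  shows "ideal I (ring_of_type_algebra\<lparr>carrier := R\<rparr>) \<longleftrightarrow>
    0 \<in> I \<and> I \<subseteq> R \<and> (\<forall>a\<in>I. \<forall>b\<in>I. a + b \<in> I) \<and> (\<forall>r\<in>R. \<forall>a\<in>I. r * a \<in> I)" (is "_ \<longleftrightarrow> ?rhs")
proof
  interpret R: cring "ring_of_type_algebra\<lparr>carrier := R\<rparr>" by (rule cring_restrict[OF R])
  assume "ideal I (ring_of_type_algebra\<lparr>carrier := R\<rparr>)"
  then interpret I: ideal I "ring_of_type_algebra\<lparr>carrier := R\<rparr>" .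
  show ?rhs
    using I.zero_closed I.a_subset I.a_closed I.I_l_closed by auto
next
  interpret R: cring "ring_of_type_algebra\<lparr>carrier := R\<rparr>" by (rule cring_restrict[OF R])
  assume I: ?rhs
  show "ideal I (ring_of_type_algebra\<lparr>carrier := R\<rparr>)"
  proof (rule idealI)
    show "ring (ring_of_type_algebra\<lparr>carrier := R\<rparr>)" by (rule R.ring_axioms)
    have neg: "- a \<in> I" if "a \<in> I" for a
    proof -
      have "(- 1) * a \<in> I" using I that type_subringD[OF R] by blast
      then show ?thesis by simp
    qed
    show "subgroup I (add_monoid (ring_of_type_algebra\<lparr>carrier := R\<rparr>))"
    proof (rule group.subgroupI[OF R.a_group])
      show "I \<subseteq> carrier (add_monoid (ring_of_type_algebra\<lparr>carrier := R\<rparr>))" "I \<noteq> {}"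
        using I by auto
      show "inv\<^bsub>add_monoid (ring_of_type_algebra\<lparr>carrier := R\<rparr>)\<^esub> a \<in> I" if "a \<in> I" for a
        using restrict_a_inv[OF R, of a] I neg that unfolding a_inv_def by auto
      show "a \<otimes>\<^bsub>add_monoid (ring_of_type_algebra\<lparr>carrier := R\<rparr>)\<^esub> b \<in> I"
        if "a \<in> I" "b \<in> I" for a b
        using I that by simp
    qed
    have "a * r \<in> I" if "a \<in> I" "r \<in> R" for a r
      using I that by (metis mult.commute)
    then show "a \<otimes>\<^bsub>ring_of_type_algebra\<lparr>carrier := R\<rparr>\<^esub> r \<in> I"
      "r \<otimes>\<^bsub>ring_of_type_algebra\<lparr>carrier := R\<rparr>\<^esub> a \<in> I"
      if "a \<in> I" "r \<in> carrier (ring_of_type_algebra\<lparr>carrier := R\<rparr>)" for a r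
      using I that by auto
  qed
qed

lemma maximalideal_restrict_prime:
  assumes R: "type_subring R" and m: "maximalideal \<mm> (ring_of_type_algebra\<lparr>carrier := R\<rparr>)"
  shows "0 \<in> \<mm>" "\<mm> \<subseteq> R" "1 \<notin> \<mm>" "a \<in> R \<Longrightarrow> b \<in> R \<Longrightarrow> a * b \<in> \<mm> \<Longrightarrow> a \<in> \<mm> \<or> b \<in> \<mm>"
proof -
  interpret R: cring "ring_of_type_algebra\<lparr>carrier := R\<rparr>" by (rule cring_restrict[OF R])
  interpret p: primeideal \<mm> "ring_of_type_algebra\<lparr>carrier := R\<rparr>"
    by (rule R.maximalideal_prime[OF m])
  show "0 \<in> \<mm>" "\<mm> \<subseteq> R" "a \<in> R \<Longrightarrow> b \<in> R \<Longrightarrow> a * b \<in> \<mm> \<Longrightarrow> a \<in> \<mm> \<or> b \<in> \<mm>"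
    using p.zero_closed p.a_subset p.I_prime by auto
  show "1 \<notin> \<mm>"
    using p.I_notcarr p.one_imp_carrier by auto
qed

text \<open>Properness of an ideal is encoded as not containing \<open>1\<close>, a condition that
  survives unions of chains; so Zorn's lemma applies to the proper ideals above
  \<open>I\<close>.\<close>

lemma ex_maximalideal_restrict:
  assumes R: "type_subring R" and I: "ideal I (ring_of_type_algebra\<lparr>carrier := R\<rparr>)" and "1 \<notin> I"
  shows "\<exists>\<mm>. maximalideal \<mm> (ring_of_type_algebra\<lparr>carrier := R\<rparr>) \<and> I \<subseteq> \<mm>"
proof -
  let ?R = "ring_of_type_algebra\<lparr>carrier := R\<rparr>"
  let ?A = "{J. ideal J ?R \<and> I \<subseteq> J \<and> 1 \<notin> J}"
  have "\<exists>M\<in>?A. \<forall>Y\<in>?A. M \<subseteq> Y \<longrightarrow> Y = M"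
  proof (rule subset_Zorn_nonempty)
    show "?A \<noteq> {}" using assms by auto
    fix C assume C: "C \<noteq> {}" "subset.chain ?A C"
    then have CA: "\<And>J. J \<in> C \<Longrightarrow> J \<in> ?A" and tot: "\<And>J L. J \<in> C \<Longrightarrow> L \<in> C \<Longrightarrow> J \<subseteq> L \<or> L \<subseteq> J"
      unfolding subset.chain_def by auto
    have "ideal (\<Union>C) ?R"
      unfolding ideal_restrict_iff[OF R]
    proof (intro conjI ballI)
      show "0 \<in> \<Union>C" using C(1) CA ideal_restrict_iff[OF R] by auto
      have "J \<subseteq> R" if "J \<in> C" for J using CA[OF that] ideal_restrict_iff[OF R] by auto
      then show "\<Union>C \<subseteq> R" by (rule Union_least)
      fix a b assume "a \<in> \<Union>C" "b \<in> \<Union>C"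
      then obtain J L where JL: "J \<in> C" "a \<in> J" "L \<in> C" "b \<in> L" by auto
      have add: "a' + b' \<in> I'" if "I' \<in> C" "a' \<in> I'" "b' \<in> I'" for I' a' b'
        using CA[OF that(1)] that(2,3) ideal_restrict_iff[OF R] by auto
      have "J \<subseteq> L \<or> L \<subseteq> J" using tot JL by auto
      then show "a + b \<in> \<Union>C"
      proof
        assume "J \<subseteq> L"
        then have "a + b \<in> L" using add JL by blast
        then show ?thesis using JL by blast
      next
        assume "L \<subseteq> J"
        then have "a + b \<in> J" using add JL by blast
        then show ?thesis using JL by blast
      qed
    next
      fix r a assume "r \<in> R" "a \<in> \<Union>C"
      then obtain J where J: "J \<in> C" "a \<in> J" by auto
      then have "r * a \<in> J" using CA[OF J(1)] \<open>r \<in> R\<close> ideal_restrict_iff[OF R] by auto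
      then show "r * a \<in> \<Union>C" using J by blast
    qed
    then show "\<Union>C \<in> ?A" using C(1) CA by auto
  qed
  then obtain M where M: "M \<in> ?A" "\<forall>Y\<in>?A. M \<subseteq> Y \<longrightarrow> Y = M" by (elim bexE)
  have "maximalideal M ?R"
  proof (rule maximalidealI)
    show "ideal M ?R" "carrier ?R \<noteq> M" using M type_subringD(1)[OF R] by auto
    fix J assume J: "ideal J ?R" "M \<subseteq> J" "J \<subseteq> carrier ?R"
    show "J = M \<or> J = carrier ?R"
    proof (cases "1 \<in> J")
      case True
      then have "r \<in> J" if "r \<in> R" for r
        using J(1) that unfolding ideal_restrict_iff[OF R] by (metis mult.right_neutral)
      then show ?thesis using J(3) by auto
    qed (use J M(1) M(2)[rule_format, of J] in auto)
  qed
  then show ?thesis using M by blast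
qed

text \<open>The denominators of \<open>f\<close> form an ideal of \<open>R\<close>, contained in no maximal ideal.\<close>

lemma mem_if_mem_localizations:
  assumes R: "type_subring R"
    and f: "\<And>\<mm>. maximalideal \<mm> (ring_of_type_algebra\<lparr>carrier := R\<rparr>) \<Longrightarrow>
      \<exists>a b. f = a / b \<and> a \<in> R \<and> b \<in> R \<and> b \<notin> \<mm>"
  shows "f \<in> R"
proof (rule ccontr)
  assume "f \<notin> R"
  let ?D = "{b\<in>R. b * f \<in> R}"
  have "ideal ?D (ring_of_type_algebra\<lparr>carrier := R\<rparr>)"
    unfolding ideal_restrict_iff[OF R] using type_subringD[OF R]
    by (auto simp: distrib_right mult.assoc)
  moreover have "1 \<notin> ?D" using \<open>f \<notin> R\<close> by simp
  ultimately obtain \<mm> where m: "maximalideal \<mm> (ring_of_type_algebra\<lparr>carrier := R\<rparr>)" "?D \<subseteq> \<mm>"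
    using ex_maximalideal_restrict[OF R] by blast
  obtain a b where ab: "f = a / b" "a \<in> R" "b \<in> R" "b \<notin> \<mm>" using f[OF m(1)] by blast
  have "b \<noteq> 0" using ab(4) maximalideal_restrict_prime[OF R m(1)] by auto
  then have "b \<in> ?D" using ab by simp
  then show False using m(2) ab(4) by blast
qed

section \<open>Values of multivariate polynomials\<close>

definition monomial_value :: "(nat \<Rightarrow> 'k::field) \<Rightarrow> (nat \<Rightarrow>\<^sub>0 nat) \<Rightarrow> 'k" where
  "monomial_value y m = (\<Prod>j\<in>Poly_Mapping.keys m. y j ^ Poly_Mapping.lookup m j)"

lemma monomial_value_superset:
  assumes "finite J" "Poly_Mapping.keys m \<subseteq> J"
  shows "monomial_value y m = (\<Prod>j\<in>J. y j ^ Poly_Mapping.lookup m j)"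
  unfolding monomial_value_def
  by (rule prod.mono_neutral_left) (use assms in \<open>auto simp: in_keys_iff\<close>)

lemma monomial_value_add:
  "monomial_value y (m + m') = monomial_value y m * monomial_value y m'"
proof -
  let ?J = "Poly_Mapping.keys m \<union> Poly_Mapping.keys m'"
  show ?thesis
    using monomial_value_superset[of ?J m y] monomial_value_superset[of ?J m' y]
      monomial_value_superset[of ?J "m + m'" y] Poly_Mapping.keys_add[of m m']
    by (simp add: lookup_add power_add prod.distrib)
qed

lemma mpoly_eval_superset:
  assumes "finite S" "Poly_Mapping.keys f \<subseteq> S"
  shows "mpoly_eval y f = (\<Sum>m\<in>S. Poly_Mapping.lookup f m * monomial_value y m)"
  unfolding mpoly_eval_def monomial_value_def[symmetric]
  by (rule sum.mono_neutral_left) (use assms in \<open>auto simp: in_keys_iff\<close>)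

lemma mpoly_eval_diff: "mpoly_eval y (f - g) = mpoly_eval y f - mpoly_eval y g"
proof -
  let ?S = "Poly_Mapping.keys f \<union> Poly_Mapping.keys g"
  have "Poly_Mapping.keys (f - g) \<subseteq> ?S"
    by (rule keys_diff)
  then show ?thesis
    using mpoly_eval_superset[of ?S f y] mpoly_eval_superset[of ?S g y]
      mpoly_eval_superset[of ?S "f - g" y]
    by (simp add: lookup_minus left_diff_distrib sum_subtractf)
qed

lemma mpoly_eval_single: "mpoly_eval y (Poly_Mapping.single m c) = c * monomial_value y m"
  using mpoly_eval_superset[of "{m}" "Poly_Mapping.single m c" y] by simp

lemma type_subring_mpoly_values:
  assumes F: "type_subring F"
  shows "type_subring (mpoly_eval y ` mpolys F n)" (is "type_subring ?R")
proof -
  have diff: "a - b \<in> ?R" if ab: "a \<in> ?R" "b \<in> ?R" for a b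
  proof -
    obtain f g where fg: "f \<in> mpolys F n" "a = mpoly_eval y f" "g \<in> mpolys F n" "b = mpoly_eval y g"
      using ab by auto
    have "f - g \<in> mpolys F n"
      using fg(1,3) type_subringD(4)[OF F] subsetD[OF keys_diff[of f g]] unfolding mpolys_def
      by (fastforce simp: lookup_minus)
    then show ?thesis using fg by (metis image_eqI mpoly_eval_diff)
  qed
  have mono: "c * monomial_value y m \<in> ?R" if "c \<in> F" "Poly_Mapping.keys m \<subseteq> {..n}" for c m
  proof -
    have "Poly_Mapping.single m c \<in> mpolys F n"
      unfolding mpolys_def using that type_subringD[OF F] by (auto simp: lookup_single when_def)
    then show ?thesis by (metis image_eqI mpoly_eval_single)
  qed
  have one: "1 \<in> ?R"
    using mono[of 1 0] type_subringD[OF F] by (simp add: monomial_value_def)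
  have zero: "0 \<in> ?R" using diff[OF one one] by simp
  have add: "a + b \<in> ?R" if "a \<in> ?R" "b \<in> ?R" for a b
    using diff[OF that(1) diff[OF zero that(2)]] by simp
  have sum: "sum h I \<in> ?R" if "\<And>i. i \<in> I \<Longrightarrow> h i \<in> ?R" for h :: "(nat \<Rightarrow>\<^sub>0 nat) \<Rightarrow> 'a" and I
    using that by (induction I rule: infinite_finite_induct) (auto intro: zero add)
  have "a * b \<in> ?R" if ab: "a \<in> ?R" "b \<in> ?R" for a b
  proof -
    obtain f g where fg: "f \<in> mpolys F n" "a = mpoly_eval y f" "g \<in> mpolys F n" "b = mpoly_eval y g"
      using ab by auto
    \<comment> \<open>Closure under products is checked on values: the expanded double sum consists
      of terms \<open>c * monomial_value y m\<close>, each the value of a one-term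
      polynomial.\<close>
    have "a * b = (\<Sum>m\<in>Poly_Mapping.keys f. \<Sum>m'\<in>Poly_Mapping.keys g.
        (Poly_Mapping.lookup f m * Poly_Mapping.lookup g m') * monomial_value y (m + m'))"
      unfolding fg mpoly_eval_def monomial_value_def[symmetric] sum_product monomial_value_add
      by (intro sum.cong refl) (simp add: algebra_simps)
    also have "\<dots> \<in> ?R"
    proof (intro sum mono)
      fix m m' assume m: "m \<in> Poly_Mapping.keys f" "m' \<in> Poly_Mapping.keys g"
      show "Poly_Mapping.lookup f m * Poly_Mapping.lookup g m' \<in> F"
        using fg type_subringD(6)[OF F] unfolding mpolys_def by auto
      show "Poly_Mapping.keys (m + m') \<subseteq> {..n}"
        using fg m Poly_Mapping.keys_add[of m m'] unfolding mpolys_def by blast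
    qed
    finally show ?thesis .
  qed
  then show ?thesis unfolding type_subring_def using one diff by blast
qed

lemma type_subring_chart_ring:
  "type_subring F \<Longrightarrow> type_subring (chart_ring F n x i)"
  unfolding chart_ring_def by (rule type_subring_mpoly_values)

section \<open>Functions regular on all charts\<close>

text \<open>The values at \<open>x\<close> of the homogeneous polynomials of degree \<open>d\<close>
  over \<open>F\<close>. Building them one coordinate at a time makes finiteness for finite
  \<open>F\<close> an induction on \<open>d\<close>.\<close>

fun forms :: "'k::field set \<Rightarrow> nat \<Rightarrow> (nat \<Rightarrow> 'k) \<Rightarrow> nat \<Rightarrow> 'k set" where
  "forms F n x 0 = F"
| "forms F n x (Suc d) = {\<Sum>j\<le>n. x j * s j | s. \<forall>j\<le>n. s j \<in> forms F n x d}"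

lemma finite_forms:
  assumes "finite F"
  shows "finite (forms F n x d)"
proof (induction d)
  case (Suc d)
  have "forms F n x (Suc d) \<subseteq> (\<lambda>s. \<Sum>j\<le>n. x j * s j) ` (PiE {..n} (\<lambda>_. forms F n x d))"
  proof
    fix a assume "a \<in> forms F n x (Suc d)"
    then obtain s where s: "a = (\<Sum>j\<le>n. x j * s j)" "\<forall>j\<le>n. s j \<in> forms F n x d" by auto
    then have "a = (\<Sum>j\<le>n. x j * restrict s {..n} j)" "restrict s {..n} \<in> PiE {..n} (\<lambda>_. forms F n x d)"
      by auto
    then show "a \<in> (\<lambda>s. \<Sum>j\<le>n. x j * s j) ` (PiE {..n} (\<lambda>_. forms F n x d))" by blast
  qed
  moreover have "finite (PiE {..n} (\<lambda>_. forms F n x d))" by (rule finite_PiE) (use Suc in auto)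
  ultimately show ?case using finite_surj by blast
qed (use assms in simp)

lemma forms_zero: "type_subring F \<Longrightarrow> 0 \<in> forms F n x d"
proof (induction d)
  case (Suc d)
  then show ?case by (auto intro!: exI[of _ "\<lambda>_. 0"])
qed (simp add: type_subringD)

lemma forms_add:
  assumes "type_subring F" "a \<in> forms F n x d" "b \<in> forms F n x d"
  shows "a + b \<in> forms F n x d"
  using assms(2,3)
proof (induction d arbitrary: a b)
  case (Suc d)
  then obtain s t where st: "a = (\<Sum>j\<le>n. x j * s j)" "\<forall>j\<le>n. s j \<in> forms F n x d"
    "b = (\<Sum>j\<le>n. x j * t j)" "\<forall>j\<le>n. t j \<in> forms F n x d" by auto
  have "a + b = (\<Sum>j\<le>n. x j * (s j + t j))" using st by (simp add: distrib_left sum.distrib)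
  then show ?case using st Suc.IH by (auto intro!: exI[of _ "\<lambda>j. s j + t j"])
qed (use assms(1) in \<open>simp add: type_subringD\<close>)

lemma forms_sum:
  assumes "type_subring F" "\<And>i. i \<in> I \<Longrightarrow> h i \<in> forms F n x d"
  shows "sum h I \<in> forms F n x d"
  using assms(2)
  by (induction I rule: infinite_finite_induct) (auto intro: forms_zero forms_add assms(1))

lemma forms_coord_mult:
  assumes "type_subring F" "i \<le> n" "a \<in> forms F n x d"
  shows "x i * a \<in> forms F n x (Suc d)"
proof -
  have "x i * a = (\<Sum>j\<le>n. x j * (if j = i then a else 0))"
    using assms(2) by (simp add: if_distrib[of "\<lambda>z. x _ * z"] sum.delta cong: if_cong)
  then show ?thesis using assms forms_zero[OF assms(1)] 
    by (auto intro!: exI[of _ "\<lambda>j. if j = i then a else 0"])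
qed

lemma forms_const_mult:
  assumes "type_subring F" "c \<in> F" "a \<in> forms F n x d"
  shows "c * a \<in> forms F n x d"
  using assms(3)
proof (induction d arbitrary: a)
  case (Suc d)
  then obtain s where s: "a = (\<Sum>j\<le>n. x j * s j)" "\<forall>j\<le>n. s j \<in> forms F n x d" by auto
  have "c * a = (\<Sum>j\<le>n. x j * (c * s j))" using s by (simp add: sum_distrib_left mult.left_commute)
  then show ?case using s Suc.IH by (auto intro!: exI[of _ "\<lambda>j. c * s j"])
qed (use assms in \<open>simp add: type_subringD\<close>)

lemma forms_mult:
  assumes "type_subring F" "a \<in> forms F n x d" "b \<in> forms F n x e"
  shows "a * b \<in> forms F n x (d + e)"
  using assms(2)
proof (induction d arbitrary: a)
  case 0
  then show ?case using forms_const_mult[OF assms(1) _ assms(3)] by simp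
next
  case (Suc d)
  then obtain s where s: "a = (\<Sum>j\<le>n. x j * s j)" "\<forall>j\<le>n. s j \<in> forms F n x d" by auto
  have "a * b = (\<Sum>j\<le>n. x j * (s j * b))" using s by (simp add: sum_distrib_right mult.assoc)
  then show ?case using s Suc.IH by (auto intro!: exI[of _ "\<lambda>j. s j * b"])
qed

lemma forms_power:
  assumes "type_subring F" "i \<le> n"
  shows "x i ^ d \<in> forms F n x d"
proof (induction d)
  case (Suc d)
  then show ?case using forms_coord_mult[OF assms] by simp
qed (simp add: type_subringD assms)

lemma forms_monomial:
  assumes "type_subring F" "J \<subseteq> {..n}"
  shows "(\<Prod>j\<in>J. x j ^ e j) \<in> forms F n x (\<Sum>j\<in>J. e j)"
proof -
  have "finite J" using assms(2) finite_subset by blast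
  then show ?thesis using assms(2)
  proof (induction J)
    case (insert j J)
    then show ?case using forms_mult[OF assms(1) forms_power[OF assms(1), of j n x "e j"]] by simp
  qed (simp add: type_subringD assms)
qed

text \<open>Homogenization: a power of \<open>x i\<close> clears the denominators of the chart
  coordinates.\<close>

lemma chart_ring_imp_form:
  assumes F: "type_subring F" and i: "i \<le> n" "x i \<noteq> 0" and "f \<in> chart_ring F n x i"
  shows "\<exists>d. x i ^ d * f \<in> forms F n x d"
proof -
  obtain h where h: "h \<in> mpolys F n" "f = mpoly_eval (chart_coord x i) h"
    using assms(4) unfolding chart_ring_def by auto
  define deg where "deg m = (\<Sum>j\<le>n. Poly_Mapping.lookup m j)" for m :: "nat \<Rightarrow>\<^sub>0 nat"
  \<comment> \<open>A crude bound on the degrees of all monomials; surplus degree is absorbed by the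
    factor \<open>x i ^ (d - deg m)\<close>.\<close>
  define d where "d = (\<Sum>m\<in>Poly_Mapping.keys h. deg m)"
  have "x i ^ d * f = (\<Sum>m\<in>Poly_Mapping.keys h. x i ^ d *
      (Poly_Mapping.lookup h m * monomial_value (chart_coord x i) m))"
    unfolding h(2) mpoly_eval_def monomial_value_def sum_distrib_left ..
  also have "\<dots> \<in> forms F n x d"
  proof (rule forms_sum[OF F])
    fix m assume m: "m \<in> Poly_Mapping.keys h"
    have "deg m \<le> d" unfolding d_def by (rule member_le_sum) (use m in auto)
    then have d: "d = (d - deg m) + deg m" by simp
    have mn: "Poly_Mapping.keys m \<subseteq> {..n}" using h(1) m unfolding mpolys_def by auto
    have "monomial_value (chart_coord x i) m * x i ^ deg m = (\<Prod>j\<le>n. x j ^ Poly_Mapping.lookup m j)"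
      unfolding monomial_value_superset[OF finite_atMost mn] deg_def power_sum
        prod.distrib[symmetric] chart_coord_def power_mult_distrib[symmetric]
      using i(2) by simp
    then have "x i ^ d * (Poly_Mapping.lookup h m * monomial_value (chart_coord x i) m) =
        Poly_Mapping.lookup h m * (x i ^ (d - deg m) * (\<Prod>j\<le>n. x j ^ Poly_Mapping.lookup m j))"
      by (subst d) (simp add: power_add mult_ac)
    moreover have "\<dots> \<in> forms F n x ((d - deg m) + deg m)"
      using h(1) forms_monomial[OF F, of "{..n}" n x "Poly_Mapping.lookup m"]
      unfolding mpolys_def deg_def
      by (intro forms_const_mult[OF F] forms_mult[OF F] forms_power[OF F i(1)]) auto
    ultimately show "x i ^ d * (Poly_Mapping.lookup h m * monomial_value (chart_coord x i) m) \<in> forms F n x d"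
      by (simp only: d[symmetric])
  qed
  finally show ?thesis by blast
qed

text \<open>
  Multiplication by a function regular on all charts preserves the forms of a large degree \<open>d\<close>: by the
  pigeonhole principle every monomial of degree \<open>d\<close> contains a large power of some coordinate.
\<close>

lemma regular_mult_forms:
  assumes F: "type_subring F"
    and f: "\<And>i. i \<le> n \<Longrightarrow> x i \<noteq> 0 \<Longrightarrow> f \<in> chart_ring F n x i"
  shows "\<exists>d. \<forall>a\<in>forms F n x d. f * a \<in> forms F n x d"
proof -
  have "\<forall>i. \<exists>d. i \<le> n \<longrightarrow> x i \<noteq> 0 \<longrightarrow> x i ^ d * f \<in> forms F n x d"
    using chart_ring_imp_form[where x = x, OF F _ _ f] by blast
  then obtain D where D: "\<And>i. i \<le> n \<Longrightarrow> x i \<noteq> 0 \<Longrightarrow> x i ^ D i * f \<in> forms F n x (D i)"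
    by metis
  define E where "E = (\<Sum>i\<le>n. D i)"
  have DE: "D i \<le> E" if "i \<le> n" for i
    unfolding E_def by (rule member_le_sum) (use that in auto)
  \<comment> \<open>If all \<open>Suc n\<close> exponents were at most \<open>E\<close>, their sum
    would be at most \<open>Suc n * E\<close>. So one of them exceeds \<open>E\<close>, hence also
    the \<open>D i\<close> for which \<open>x i ^ D i\<close> absorbs \<open>f\<close>.\<close>
  have mono: "f * (\<Prod>j\<le>n. x j ^ e j) \<in> forms F n x (\<Sum>j\<le>n. e j)"
    if e: "Suc n * E < (\<Sum>j\<le>n. e j)" for e
  proof -
    obtain i where i: "i \<le> n" "E < e i"
    proof (rule ccontr)
      assume "\<not> thesis"
      then have "(\<Sum>j\<le>n. e j) \<le> of_nat (card {..n}) * E"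
        using that by (intro sum_bounded_above) (metis atMost_iff not_le)
      then show False using e by simp
    qed
    show ?thesis
    proof (cases "x i = 0")
      \<comment> \<open>There is no chart at this \<open>i\<close>, so \<open>D i\<close> gives
        nothing; but then the whole monomial vanishes.\<close>
      case True
      then have "(\<Prod>j\<le>n. x j ^ e j) = 0" using i by auto
      then show ?thesis by (simp only: mult_zero_right forms_zero[OF F])
    next
      case False
      have le: "D i \<le> e i" using DE[OF i(1)] i(2) by simp
      let ?J = "{..n} - {i}"
      have "(\<Prod>j\<le>n. x j ^ e j) = x i ^ e i * (\<Prod>j\<in>?J. x j ^ e j)"
        using i by (simp add: prod.remove)
      also have "x i ^ e i = x i ^ D i * x i ^ (e i - D i)"
        using le by (simp flip: power_add)
      finally have "f * (\<Prod>j\<le>n. x j ^ e j) =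
          (x i ^ D i * f) * (x i ^ (e i - D i) * (\<Prod>j\<in>?J. x j ^ e j))"
        by (simp add: mult_ac)
      also have "\<dots> \<in> forms F n x (D i + ((e i - D i) + (\<Sum>j\<in>?J. e j)))"
        by (intro forms_mult[OF F] D i False forms_power[OF F] forms_monomial[OF F]) auto
      also have "D i + ((e i - D i) + (\<Sum>j\<in>?J. e j)) = (\<Sum>j\<le>n. e j)"
        using le i by (simp add: sum.remove)
      finally show ?thesis .
    qed
  qed
  \<comment> \<open>The induction on \<open>d\<close> strips coordinates off the form
    \<open>a\<close> and collects them in the monomial in front, keeping the total degree. At
    \<open>d = 0\<close> a constant times a monomial is left, to which \<open>mono\<close>
    applies.\<close>
  have large: "f * ((\<Prod>j\<le>n. x j ^ e j) * a) \<in> forms F n x ((\<Sum>j\<le>n. e j) + d)"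
    if "a \<in> forms F n x d" "Suc n * E < (\<Sum>j\<le>n. e j) + d" for a d e
    using that
  proof (induction d arbitrary: a e)
    case 0
    then show ?case using forms_const_mult[OF F _ mono, of a e] by (simp add: mult_ac)
  next
    case (Suc d)
    then obtain s where s: "a = (\<Sum>j\<le>n. x j * s j)" "\<forall>j\<le>n. s j \<in> forms F n x d" by auto
    have "f * ((\<Prod>j\<le>n. x j ^ e j) * a) = (\<Sum>i\<le>n. f * ((\<Prod>j\<le>n. x j ^ e j) * (x i * s i)))"
      unfolding s(1) by (simp add: sum_distrib_left)
    also have "\<dots> \<in> forms F n x ((\<Sum>j\<le>n. e j) + Suc d)"
    proof (rule forms_sum[OF F])
      fix i assume i: "i \<in> {..n}"
      let ?e = "\<lambda>j. if j = i then Suc (e j) else e j"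
      have p: "(\<Prod>j\<le>n. x j ^ ?e j) = (\<Prod>j\<le>n. x j ^ e j) * x i"
        using i by (simp add: prod.remove[of "{..n}" i])
      have q: "(\<Sum>j\<le>n. ?e j) = Suc (\<Sum>j\<le>n. e j)"
        using i by (simp add: sum.remove[of "{..n}" i])
      show "f * ((\<Prod>j\<le>n. x j ^ e j) * (x i * s i)) \<in> forms F n x ((\<Sum>j\<le>n. e j) + Suc d)"
        using Suc.IH[of "s i" ?e] s i Suc.prems(2) unfolding p q by (simp add: mult_ac)
    qed
    finally show ?case .
  qed
  have "f * a \<in> forms F n x (Suc (Suc n * E))" if "a \<in> forms F n x (Suc (Suc n * E))" for a
    using large[OF that, of "\<lambda>_. 0"] by (simp del: forms.simps mult_Suc)
  then show ?thesis by blast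
qed

text \<open>All \<open>f ^ k * x i ^ d\<close> lie in one finite set of forms, so two of them
  coincide, and the nonzero factor \<open>x i ^ d\<close> cancels.\<close>

lemma regular_imp_root_of_unity:
  assumes "finite F" and F: "type_subring F" and "\<exists>i\<le>n. x i \<noteq> 0"
    and f: "\<And>i. i \<le> n \<Longrightarrow> x i \<noteq> 0 \<Longrightarrow> f \<in> chart_ring F n x i"
  shows "f = 0 \<or> (\<exists>k>0. f ^ k = 1)"
proof -
  obtain i where i: "i \<le> n" "x i \<noteq> 0" using assms(3) by auto
  obtain d where d: "\<And>a. a \<in> forms F n x d \<Longrightarrow> f * a \<in> forms F n x d"
    using regular_mult_forms[OF F f] by auto
  have mem: "f ^ k * x i ^ d \<in> forms F n x d" for k
  proof (induction k)
    case (Suc k)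
    then show ?case using d by (simp add: mult.assoc)
  qed (use forms_power[OF F i(1)] in simp)
  have "\<not> inj (\<lambda>k. f ^ k * x i ^ d)"
    using finite_forms[OF assms(1), of n x d] mem finite_imageD[of "\<lambda>k. f ^ k * x i ^ d" UNIV]
    by (metis finite_subset image_subsetI infinite_UNIV_nat)
  then obtain k l where "k < l" "f ^ k * x i ^ d = f ^ l * x i ^ d"
    unfolding inj_def by (metis linorder_neqE_nat)
  then have "f ^ k = f ^ l" using i by simp
  also have "\<dots> = f ^ k * f ^ (l - k)" using \<open>k < l\<close> by (simp flip: power_add)
  finally show ?thesis using \<open>k < l\<close> by (cases "f = 0") (auto intro!: exI[of _ "l - k"])
qed

section \<open>Finiteness of residue fields\<close>

text \<open>Used twice: for \<open>val_abs q \<nu>\<close> on the completion and for its pullback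
  along \<open>\<iota>\<close> to the function field.\<close>

locale nonarch_abs =
  fixes v :: "'k::field \<Rightarrow> real"
  assumes v_zero [simp]: "v 0 = 0"
    and v_pos: "a \<noteq> 0 \<Longrightarrow> 0 < v a"
    and v_mult [simp]: "v (a * b) = v a * v b"
    and v_add: "v (a + b) \<le> max (v a) (v b)"
begin

lemma v_nonneg [simp]: "0 \<le> v a"
  using v_pos[of a] by (cases "a = 0") auto

lemma v_eq_0_iff [simp]: "v a = 0 \<longleftrightarrow> a = 0"
  using v_pos[of a] by (cases "a = 0") auto

lemma v_one [simp]: "v 1 = 1"
  using v_mult[of 1 1] v_pos[of 1] by simp

lemma v_power [simp]: "v (a ^ k) = v a ^ k"
  by (induction k) auto

lemma v_root_of_unity: "a ^ k = 1 \<Longrightarrow> 0 < k \<Longrightarrow> v a = 1"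
  by (metis v_power v_one v_nonneg power_eq_1_iff less_numeral_extra(3) abs_of_nonneg real_norm_def)

lemma v_minus [simp]: "v (- a) = v a"
proof -
  have "v (- 1) = 1" by (rule v_root_of_unity[of _ 2]) simp_all
  then show ?thesis using v_mult[of "- 1" a] by simp
qed

lemma v_diff: "v (a - b) \<le> max (v a) (v b)"
  using v_add[of a "- b"] by simp

lemma v_inverse [simp]: "v (inverse a) = inverse (v a)"
proof (cases "a = 0")
  case False
  then have "v a * v (inverse a) = 1" by (simp flip: v_mult)
  then show ?thesis by (simp add: inverse_unique)
qed simp

lemma v_divide [simp]: "v (a / b) = v a / v b"
  by (simp add: divide_inverse)

lemma v_minus_commute: "v (a - b) = v (b - a)"
  using v_minus[of "a - b"] by simp

lemma v_sum_le:
  assumes "\<And>i. i \<in> I \<Longrightarrow> v (h i) \<le> M" "0 \<le> M"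
  shows "v (sum h I) \<le> M"
  using assms(1)
proof (induction I rule: infinite_finite_induct)
  case (insert i I)
  then have "max (v (h i)) (v (sum h I)) \<le> M" by simp
  then show ?case using insert v_add[of "h i" "sum h I"] by (simp del: max.bounded_iff)
qed (use assms(2) in auto)

lemma v_sum_less:
  assumes "\<And>i. i \<in> I \<Longrightarrow> v (h i) < M" "0 < M"
  shows "v (sum h I) < M"
  using assms(1)
proof (induction I rule: infinite_finite_induct)
  case (insert i I)
  then have "max (v (h i)) (v (sum h I)) < M" by simp
  then show ?case using insert v_add[of "h i" "sum h I"] by (simp del: max_less_iff_conj)
qed (use assms(2) in auto)

lemma v_add_less: "v a < M \<Longrightarrow> v b < M \<Longrightarrow> v (a + b) < M"
  using v_add[of a b] by simp

lemma v_add_le: "v a \<le> M \<Longrightarrow> v b \<le> M \<Longrightarrow> v (a + b) \<le> M"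
  using v_add[of a b] by simp

lemma v_diff_trans: "v (a - b) < M \<Longrightarrow> v (b - c) < M \<Longrightarrow> v (a - c) < M"
  using v_add_less[of "a - b" M "b - c"] by simp

lemma v_le_1_trans: "v a \<le> 1 \<Longrightarrow> v (a - b) < 1 \<Longrightarrow> v b \<le> 1"
  using v_diff[of a "a - b"] by simp

lemma v_eq_1_trans: "v a = 1 \<Longrightarrow> v (a - b) < 1 \<Longrightarrow> v b = 1"
  using v_diff[of a "a - b"] v_add[of b "a - b"] by simp

text \<open>\<open>v (a - s) < 1\<close> is congruence modulo the maximal ideal of the valuation
  ring. Integrality of \<open>s'\<close> is inherited from \<open>b\<close>.\<close>

lemma v_mult_less:
  assumes "v a \<le> 1" "v (a - s) < 1" "v b \<le> 1" "v (b - s') < 1"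
  shows "v (a * b - s * s') < 1"
proof -
  have "v s' \<le> 1" using v_le_1_trans assms by blast
  have "v (a * (b - s')) < 1" 
    using assms mult_left_le_one_le[of "v (b - s')" "v a"] by simp
  moreover have "v ((a - s) * s') < 1"
    using assms \<open>v s' \<le> 1\<close> mult_right_le_one_le[of "v (a - s)" "v s'"] by simp
  moreover have "a * b - s * s' = a * (b - s') + (a - s) * s'" by (simp add: algebra_simps)
  ultimately show ?thesis by (metis v_add_less)
qed

lemma v_prod_less:
  assumes "finite I" "\<And>i. i \<in> I \<Longrightarrow> v (a i) \<le> 1" "\<And>i. i \<in> I \<Longrightarrow> v (a i - s i) < 1"
  shows "v (prod a I) \<le> 1 \<and> v (prod a I - prod s I) < 1"
  using assms
proof (induction I)
  case (insert i I)
  then have "v (prod a I) \<le> 1" "v (prod a I - prod s I) < 1" "v (a i) \<le> 1" "v (a i - s i) < 1"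
    by auto
  then show ?case using insert v_mult_less[of "a i" "s i" "prod a I" "prod s I"]
    by (auto intro: mult_le_one)
qed simp

lemma v_divide_less:
  assumes "v a \<le> 1" "v (a - s) < 1" "v b = 1" "v (b - s') < 1"
  shows "v (a / b - s / s') < 1"
proof -
  have s': "v s' = 1" using v_eq_1_trans assms by blast
  then have "b \<noteq> 0" "s' \<noteq> 0" using assms by auto
  then have "a / b - s / s' = (a * s' - s * b) / (b * s')" by (simp add: field_simps)
  moreover have "v (a * s' - s * b) < 1"
    using v_mult_less[of a s s' b] assms s' by (simp add: v_minus_commute)
  ultimately show ?thesis using assms s' by simp
qed

text \<open>For the valuation ring this is finiteness of the residue field. The representatives may
  lie outside \<open>A\<close>, so the property passes to subsets.\<close>

definition residue_finite :: "'k set \<Rightarrow> bool" where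
  "residue_finite A \<longleftrightarrow> (\<exists>S. finite S \<and> (\<forall>a\<in>A. \<exists>s\<in>S. v (a - s) < 1))"

lemma residue_finite_fractions:
  assumes "residue_finite A" "\<And>a. a \<in> A \<Longrightarrow> v a \<le> 1"
  shows "residue_finite {a / b | a b. a \<in> A \<and> b \<in> A \<and> v b = 1}"
proof -
  obtain S where S: "finite S" "\<And>a. a \<in> A \<Longrightarrow> \<exists>s\<in>S. v (a - s) < 1"
    using assms(1) unfolding residue_finite_def by blast
  let ?S = "(\<lambda>(s, s'). s / s') ` (S \<times> S)"
  have "\<exists>s\<in>?S. v (a / b - s) < 1" if ab: "a \<in> A" "b \<in> A" "v b = 1" for a b
  proof -
    obtain s s' where s: "s \<in> S" "v (a - s) < 1" "s' \<in> S" "v (b - s') < 1"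
      using S(2)[OF ab(1)] S(2)[OF ab(2)] by blast
    then have "v (a / b - s / s') < 1" using v_divide_less ab assms(2) by blast
    then show ?thesis using s by blast
  qed
  then show ?thesis
    unfolding residue_finite_def using S(1) by (intro exI[of _ ?S]) auto
qed

end

section \<open>Polynomials and rational functions over a subfield\<close>

definition polys_over :: "'k::field set \<Rightarrow> 'k poly set" where
  "polys_over F = {p. \<forall>i. poly.coeff p i \<in> F}"

definition type_subfield :: "'k::field set \<Rightarrow> bool" where
  "type_subfield F \<longleftrightarrow> type_subring F \<and> (\<forall>a\<in>F. inverse a \<in> F)"

lemma type_subfieldD:
  assumes "type_subfield F"
  shows "type_subring F" "a \<in> F \<Longrightarrow> inverse a \<in> F" "a \<in> F \<Longrightarrow> b \<in> F \<Longrightarrow> a / b \<in> F"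
  using assms type_subringD(6)[of F a "inverse b"] unfolding type_subfield_def
  by (auto simp: divide_inverse)

lemma type_subfield_iff:
  "subfield F (ring_of_type_algebra :: 'k::field ring) \<longleftrightarrow> type_subfield F"
proof
  interpret K: field "ring_of_type_algebra :: 'k ring" by (rule field_from_type_algebra)
  assume F: "subfield F (ring_of_type_algebra :: 'k ring)"
  have R: "type_subring F" using subfieldE(1)[OF F] by (simp add: subring_type_algebra_iff)
  have "inverse a \<in> F" if "a \<in> F" for a
    using K.subfield_m_inv(1)[OF F, of a] that type_subringD(2)[OF R] by (cases "a = 0") auto
  then show "type_subfield F" using R unfolding type_subfield_def by auto
next
  interpret K: field "ring_of_type_algebra :: 'k ring" by (rule field_from_type_algebra)
  assume F: "type_subfield F"
  show "subfield F (ring_of_type_algebra :: 'k ring)"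
    by (rule K.subfieldI') (use type_subfieldD[OF F] in \<open>auto simp: subring_type_algebra_iff\<close>)
qed

lemma polys_over_closed:
  assumes F: "type_subring F"
  shows "c \<in> F \<Longrightarrow> [:c:] \<in> polys_over F"
    "p \<in> polys_over F \<Longrightarrow> q \<in> polys_over F \<Longrightarrow> p + q \<in> polys_over F"
    "p \<in> polys_over F \<Longrightarrow> q \<in> polys_over F \<Longrightarrow> p - q \<in> polys_over F"
    "p \<in> polys_over F \<Longrightarrow> - p \<in> polys_over F"
    "p \<in> polys_over F \<Longrightarrow> q \<in> polys_over F \<Longrightarrow> p * q \<in> polys_over F"
    "c \<in> F \<Longrightarrow> Polynomial.monom c k \<in> polys_over F"
  unfolding polys_over_def using type_subringD[OF F]
  by (auto simp: Polynomial.coeff_mult coeff_pCons split: nat.split intro!: type_subring_sum[OF F])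

text \<open>Coefficients have to stay in the set \<open>F\<close>, hence the explicit long division:
  \<open>?h * g\<close> has the same leading term as \<open>p\<close>, so subtracting it lowers the
  degree or gives 0.\<close>

lemma polys_over_division:
  assumes F: "type_subfield F" and g: "g \<in> polys_over F" "g \<noteq> 0" and "p \<in> polys_over F"
  shows "\<exists>q\<in>polys_over F. \<exists>r\<in>polys_over F. p = q * g + r \<and> (r = 0 \<or> Polynomial.degree r < Polynomial.degree g)"
  using assms(4)
proof (induction "Polynomial.degree p" arbitrary: p rule: less_induct)
  case less
  note R = type_subfieldD(1)[OF F]
  have zero: "0 \<in> polys_over F" using type_subringD(2)[OF R] unfolding polys_over_def by simp
  show ?case
  proof (cases "p = 0 \<or> Polynomial.degree p < Polynomial.degree g")
    case True
    then show ?thesis using zero less.prems by (intro bexI[of _ 0] bexI[of _ p]) auto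
  next
    case False
    let ?c = "Polynomial.lead_coeff p / Polynomial.lead_coeff g"
    let ?h = "Polynomial.monom ?c (Polynomial.degree p - Polynomial.degree g)"
    have c: "?c \<in> F"
      using type_subfieldD(3)[OF F] g less.prems unfolding polys_over_def by auto
    then have h: "?h \<in> polys_over F" by (rule polys_over_closed(6)[OF R])
    have c0: "?c \<noteq> 0" using False g by simp
    let ?p = "p - ?h * g"
    have p: "?p \<in> polys_over F" using h g less.prems by (intro polys_over_closed(3,5)[OF R])
    have dh: "Polynomial.degree (?h * g) = Polynomial.degree p"
      using False c0 g by (simp add: Polynomial.degree_mult_eq Polynomial.degree_monom_eq)
    have "Polynomial.lead_coeff (?h * g) = Polynomial.lead_coeff p"
      using c0 g by (simp add: Polynomial.lead_coeff_mult Polynomial.degree_monom_eq)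
    then have cp: "poly.coeff ?p (Polynomial.degree p) = 0" using dh by simp
    have "Polynomial.degree ?p \<le> Polynomial.degree p"
      using Polynomial.degree_diff_le_max[of p "?h * g"] dh by simp
    have "?p = 0 \<or> Polynomial.degree ?p < Polynomial.degree p"
      using \<open>Polynomial.degree ?p \<le> Polynomial.degree p\<close> cp Polynomial.leading_coeff_0_iff[of ?p]
      by (metis le_neq_implies_less)
    then have "\<exists>q\<in>polys_over F. \<exists>r\<in>polys_over F. ?p = q * g + r \<and> (r = 0 \<or> Polynomial.degree r < Polynomial.degree g)"
    proof
      assume "?p = 0"
      then show ?thesis using zero by (intro bexI[of _ 0]) auto
    qed (use less.hyps p in blast)
    then obtain q r where qr: "q \<in> polys_over F" "r \<in> polys_over F" "?p = q * g + r"
      "r = 0 \<or> Polynomial.degree r < Polynomial.degree g" by blast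
    have "p = (q + ?h) * g + r" using qr(3) by (simp add: algebra_simps)
    moreover have "q + ?h \<in> polys_over F" using qr h polys_over_closed(2)[OF R] by blast
    ultimately show ?thesis using qr by blast
  qed
qed

text \<open>The field \<open>F(t)\<close>; demanding \<open>poly r t \<noteq> 0\<close> rather than
  \<open>r \<noteq> 0\<close> treats algebraic and transcendental \<open>t\<close> alike.\<close>

definition fractions_in :: "'k::field set \<Rightarrow> 'k \<Rightarrow> 'k set" where
  "fractions_in F t = {poly p t / poly r t | p r. p \<in> polys_over F \<and> r \<in> polys_over F \<and> poly r t \<noteq> 0}"

lemma fractions_inI:
  "p \<in> polys_over F \<Longrightarrow> r \<in> polys_over F \<Longrightarrow> poly r t \<noteq> 0 \<Longrightarrow> a = poly p t / poly r t \<Longrightarrow> a \<in> fractions_in F t"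
  unfolding fractions_in_def by blast

text \<open>The generator \<open>t\<close> and the variable \<open>u\<close> are kept apart because
  this is applied with \<open>u = t\<close> or \<open>u = inverse t\<close>, whichever is
  integral.\<close>

lemma generate_field_subset_fractions:
  assumes F: "type_subfield F" and t: "t \<in> fractions_in F u"
  shows "generate_field ring_of_type_algebra (F \<union> {t}) \<subseteq> fractions_in F u"
proof
  note R = type_subfieldD(1)[OF F]
  fix a assume "a \<in> generate_field ring_of_type_algebra (F \<union> {t})"
  then show "a \<in> fractions_in F u"
  proof (induction rule: generate_field.induct)
    case one
    show ?case by (rule fractions_inI[of "[:1:]" _ "[:1:]"]) (auto intro: polys_over_closed[OF R] type_subringD[OF R])
  next
    case (incl h)
    show ?case
    proof (cases "h = t")
      case False
      then show ?thesis using incl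
        by (intro fractions_inI[of "[:h:]" _ "[:1:]"]) (auto intro: polys_over_closed[OF R] type_subringD[OF R])
    qed (use t in simp)
  next
    case (a_inv h)
    then obtain p r where "p \<in> polys_over F" "r \<in> polys_over F" "poly r u \<noteq> 0" "h = poly p u / poly r u"
      unfolding fractions_in_def by blast
    then show ?case by (intro fractions_inI[of "- p" _ r]) (auto intro: polys_over_closed[OF R])
  next
    case (m_inv h)
    then obtain p r where "p \<in> polys_over F" "r \<in> polys_over F" "poly r u \<noteq> 0" "h = poly p u / poly r u"
      unfolding fractions_in_def by blast
    then show ?case using m_inv by (intro fractions_inI[of r _ p]) auto
  next
    case (eng_add h h')
    then obtain p r p' r' where "p \<in> polys_over F" "r \<in> polys_over F" "poly r u \<noteq> 0" "h = poly p u / poly r u"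
      "p' \<in> polys_over F" "r' \<in> polys_over F" "poly r' u \<noteq> 0" "h' = poly p' u / poly r' u"
      unfolding fractions_in_def by blast
    then show ?case
      by (intro fractions_inI[of "p * r' + p' * r" _ "r * r'"]) 
        (auto intro!: polys_over_closed[OF R] simp: add_frac_eq)
  next
    case (eng_mult h h')
    then obtain p r p' r' where "p \<in> polys_over F" "r \<in> polys_over F" "poly r u \<noteq> 0" "h = poly p u / poly r u"
      "p' \<in> polys_over F" "r' \<in> polys_over F" "poly r' u \<noteq> 0" "h' = poly p' u / poly r' u"
      unfolding fractions_in_def by blast
    then show ?case
      by (intro fractions_inI[of "p * p'" _ "r * r'"]) (auto intro!: polys_over_closed[OF R])
  qed
qed

text \<open>A witness of algebraicity is a list of coefficients whose head is the leading one; the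
  head becomes \<open>c d\<close>, nonzero because such lists are normalized.\<close>

lemma not_transcendental_imp_relation:
  assumes L: "type_subring L" and "\<not> ring.transcendental (ring_of_type_algebra :: 'k::field ring) L y"
  shows "\<exists>d c. (\<forall>k\<le>d. c k \<in> L) \<and> c d \<noteq> 0 \<and> (\<Sum>k\<le>d. c k * y ^ k) = 0"
proof -
  interpret K: field "ring_of_type_algebra :: 'k ring" by (rule field_from_type_algebra)
  have pow: "a [^]\<^bsub>ring_of_type_algebra\<^esub> (k :: nat) = a ^ k" for a :: 'k and k
    by (induction k) (simp_all add: mult.commute)
  have "subring L (ring_of_type_algebra :: 'k ring)" using L by (simp add: subring_type_algebra_iff)
  then obtain p where p: "p \<in> carrier (univ_poly ring_of_type_algebra L)" "p \<noteq> []" "K.eval p y = 0"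
    using K.algebraicE[of L y] assms(2) unfolding over_def by auto
  \<comment> \<open>Stated for arbitrary lists over \<open>L\<close>, since the tail of a normalized
    list may begin with 0.\<close>
  have ev: "\<exists>c. (\<forall>k. c k \<in> L) \<and> K.eval q y = (\<Sum>k<length q. c k * y ^ k)" if "set q \<subseteq> L" for q
    using that
  proof (induction q)
    case Nil
    then show ?case using type_subringD(2)[OF L] by auto
  next
    case (Cons a q)
    then obtain c where c: "\<forall>k. c k \<in> L" "K.eval q y = (\<Sum>k<length q. c k * y ^ k)" by auto
    then show ?case using Cons.prems 
      by (intro exI[of _ "c(length q := a)"]) (auto simp: pow)
  qed
  obtain a q where aq: "p = a # q" using p(2) by (cases p) auto
  have a: "a \<noteq> 0" "a \<in> L" "set q \<subseteq> L"
    using p(1) unfolding aq univ_poly_carrier[symmetric] polynomial_def by auto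
  obtain c where c: "\<forall>k. c k \<in> L" "K.eval q y = (\<Sum>k<length q. c k * y ^ k)" using ev a by blast
  have "(\<Sum>k\<le>length q. (c(length q := a)) k * y ^ k) = 0"
    using p(3) c(2) unfolding aq by (simp add: pow lessThan_Suc_atMost[symmetric] add.commute)
  then show ?thesis using c(1) a by (intro exI[of _ "length q"] exI[of _ "c(length q := a)"]) auto
qed

section \<open>Residues of rational functions and of algebraic elements\<close>

context nonarch_abs
begin

text \<open>The powers of \<open>c\<close> stay in a finite set, so \<open>c\<close> is a root of
  unity.\<close>

lemma v_finite_subfield:
  assumes "finite F" "type_subring F" "c \<in> F" "c \<noteq> 0"
  shows "v c = 1"
proof -
  have "\<not> inj (\<lambda>k. c ^ k)"
    using type_subringD(7)[OF assms(2,3)] finite_imageD[of "\<lambda>k. c ^ k" UNIV] assms(1)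
    by (metis finite_subset image_subsetI infinite_UNIV_nat)
  then obtain k l where kl: "k < l" "c ^ k = c ^ l"
    unfolding inj_def by (metis linorder_neqE_nat)
  have "c ^ k * c ^ (l - k) = c ^ l" using kl(1) by (simp flip: power_add)
  then have "c ^ k = c ^ k * c ^ (l - k)" using kl(2) by simp
  then show ?thesis using v_root_of_unity[of c "l - k"] kl assms(4) by simp
qed

lemma v_finite_subfield_le: "finite F \<Longrightarrow> type_subring F \<Longrightarrow> c \<in> F \<Longrightarrow> v c \<le> 1"
  using v_finite_subfield[of F c] by (cases "c = 0") auto

lemma v_poly_le:
  assumes "finite F" "type_subring F" "p \<in> polys_over F" "v t \<le> 1"
  shows "v (poly p t) \<le> 1"
  unfolding poly_altdef
  by (rule v_sum_le)
    (use assms v_finite_subfield_le[OF assms(1,2)] in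
      \<open>auto simp: polys_over_def intro!: mult_le_one power_le_one\<close>)

text \<open>
  A polynomial \<open>g\<close> of minimal degree with \<open>v (g t) < 1\<close> generates the ideal of all such polynomials, so it
  can be factored out of numerators and denominators, and the remainders mod \<open>g\<close> represent all residues.
\<close>

lemma residue_finite_fractions_in:
  assumes "finite F" and F: "type_subfield F" and t: "v t \<le> 1"
    and p0: "p0 \<in> polys_over F" "poly p0 t \<noteq> 0" "v (poly p0 t) \<noteq> 1"
  shows "residue_finite {a \<in> fractions_in F t. v a \<le> 1}"
proof -
  note R = type_subfieldD(1)[OF F]
  let ?G = "\<lambda>g. g \<in> polys_over F \<and> g \<noteq> 0 \<and> v (poly g t) < 1"
  have le: "v (poly p t) \<le> 1" if "p \<in> polys_over F" for p
    using v_poly_le[OF assms(1) R that t] .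
  have "?G p0" using p0 le[of p0] by auto
  then obtain g where g: "?G g" "\<And>p. ?G p \<Longrightarrow> Polynomial.degree g \<le> Polynomial.degree p"
    using ex_has_least_nat[of ?G p0 Polynomial.degree] by blast
  have dvd: "\<exists>q\<in>polys_over F. p = q * g" if p: "p \<in> polys_over F" "v (poly p t) < 1" for p
  proof -
    obtain q r where qr: "q \<in> polys_over F" "r \<in> polys_over F" "p = q * g + r"
      "r = 0 \<or> Polynomial.degree r < Polynomial.degree g"
      using polys_over_division[OF F _ _ p(1), of g] g(1) by blast
    have "v (poly q t * poly g t) < 1"
      using le[OF qr(1)] g(1) mult_left_le_one_le[of "v (poly g t)" "v (poly q t)"] by simp
    then have "v (poly p t - poly q t * poly g t) < 1"
      using p(2) v_diff[of "poly p t" "poly q t * poly g t"] by simp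
    then have "v (poly r t) < 1" using qr(3) by simp
    then have "r = 0" using g(2)[of r] qr by (cases "r = 0") auto
    then show ?thesis using qr by auto
  qed
  \<comment> \<open>\<open>t\<close> may be algebraic over \<open>F\<close>, so this has a reason of
    its own: \<open>g\<close> divides \<open>p0\<close>, whose value at \<open>t\<close> is not
    0.\<close>
  have gt: "poly g t \<noteq> 0"
    using dvd[OF p0(1)] p0 le[OF p0(1)] by auto
  have degg: "0 < Polynomial.degree g"
  proof (rule ccontr)
    assume "\<not> ?thesis"
    then obtain c where c: "g = [:c:]" by (auto elim: degree_eq_zeroE)
    then have "c \<in> F" "c \<noteq> 0" using g(1) unfolding polys_over_def by (auto dest: spec[of _ 0])
    then show False using v_finite_subfield[OF assms(1) R] g(1) c by auto
  qed
  \<comment> \<open>Each division by \<open>g\<close> lowers the degree, so the process ends with a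
    cofactor of absolute value 1 at \<open>t\<close>.\<close>
  have fac: "\<exists>j. \<exists>q\<in>polys_over F. poly p t = poly g t ^ j * poly q t \<and> v (poly q t) = 1"
    if "p \<in> polys_over F" "p \<noteq> 0" for p
    using that
  proof (induction "Polynomial.degree p" arbitrary: p rule: less_induct)
    case less
    show ?case
    proof (cases "v (poly p t) = 1")
      case True
      then show ?thesis using less.prems by (intro exI[of _ 0]) auto
    next
      case False
      then obtain q where q: "q \<in> polys_over F" "p = q * g"
        using dvd[of p] le[of p] less.prems by fastforce
      then have "q \<noteq> 0" "Polynomial.degree q < Polynomial.degree p"
        using less.prems degg by (auto simp: Polynomial.degree_mult_eq)
      then obtain j q' where "q' \<in> polys_over F" "poly q t = poly g t ^ j * poly q' t" "v (poly q' t) = 1"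
        using less.hyps q(1) by blast
      then show ?thesis using q by (intro exI[of _ "Suc j"]) auto
    qed
  qed
  define P where "P = {poly p t | p. p \<in> polys_over F}"
  have "residue_finite P"
    unfolding residue_finite_def
  proof (intro exI conjI ballI)
    \<comment> \<open>The values at \<open>t\<close> of all polynomials over \<open>F\<close> of
      degree at most that of \<open>g\<close>: they include the values of all remainders and are
      finite in number.\<close>
    let ?S = "(\<lambda>c. \<Sum>i\<le>Polynomial.degree g. c i * t ^ i) ` (PiE {..Polynomial.degree g} (\<lambda>_. F))"
    show "finite ?S" by (intro finite_imageI finite_PiE) (use assms(1) in auto)
    fix a assume "a \<in> P"
    then obtain p where p: "p \<in> polys_over F" "a = poly p t" unfolding P_def by auto
    obtain q r where qr: "q \<in> polys_over F" "r \<in> polys_over F" "p = q * g + r"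
      "r = 0 \<or> Polynomial.degree r < Polynomial.degree g"
      using polys_over_division[OF F _ _ p(1), of g] g(1) by blast
    have "v (poly q t * poly g t) < 1"
      using le[OF qr(1)] g(1) mult_left_le_one_le[of "v (poly g t)" "v (poly q t)"] by simp
    then have "v (a - poly r t) < 1" using qr(3) p(2) by simp
    moreover have rt: "poly r t = (\<Sum>i\<le>Polynomial.degree g. restrict (poly.coeff r) {..Polynomial.degree g} i * t ^ i)"
      unfolding poly_altdef
      by (rule sum.mono_neutral_cong_left) (use qr(4) in \<open>auto simp: Polynomial.coeff_eq_0\<close>)
    have "poly r t \<in> ?S"
      by (intro image_eqI[where x = "restrict (poly.coeff r) {..Polynomial.degree g}"] rt) (use qr(2) in \<open>auto simp: polys_over_def\<close>)
    ultimately show "\<exists>s\<in>?S. v (a - s) < 1" by blast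
  qed
  then have "residue_finite {a / b | a b. a \<in> P \<and> b \<in> P \<and> v b = 1}"
    by (rule residue_finite_fractions) (auto simp: P_def le)
  then obtain S where S: "finite S" "\<And>a b. a \<in> P \<Longrightarrow> b \<in> P \<Longrightarrow> v b = 1 \<Longrightarrow> \<exists>s\<in>S. v (a / b - s) < 1"
    unfolding residue_finite_def by blast
  have "\<exists>s\<in>insert 0 S. v (a - s) < 1" if a: "a \<in> fractions_in F t" "v a \<le> 1" for a
  proof (cases "v a < 1")
    case False
    then have va: "v a = 1" using \<open>v a \<le> 1\<close> by simp
    obtain p r where pr: "p \<in> polys_over F" "r \<in> polys_over F" "poly r t \<noteq> 0" "a = poly p t / poly r t"
      using a(1) unfolding fractions_in_def by blast
    then have "p \<noteq> 0" "r \<noteq> 0" using va by auto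
    then obtain j p' k r' where p': "p' \<in> polys_over F" "poly p t = poly g t ^ j * poly p' t" "v (poly p' t) = 1"
      and r': "r' \<in> polys_over F" "poly r t = poly g t ^ k * poly r' t" "v (poly r' t) = 1"
      using fac pr by meson
    \<comment> \<open>Since \<open>v (poly g t)\<close> lies strictly between 0 and 1, equal powers
      have equal exponents, and the powers of \<open>poly g t\<close> cancel in
      \<open>a\<close>.\<close>
    have "v (poly g t) ^ j = v (poly g t) ^ k"
      using va pr(3) unfolding pr(4) p'(2) r'(2) v_divide v_mult v_power p'(3) r'(3) by (auto simp: field_simps)
    then have "j = k" using gt g(1) power_inject_exp' by (metis power_strict_decreasing_iff v_pos linorder_neqE_nat less_irrefl)
    then have "a = poly p' t / poly r' t" using pr(3) gt unfolding pr(4) p'(2) r'(2) by simp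
    then show ?thesis using S(2)[of "poly p' t" "poly r' t"] p' r' unfolding P_def by blast
  qed auto
  then show ?thesis unfolding residue_finite_def using S(1) by (intro exI[of _ "insert 0 S"]) auto
qed

text \<open>Were all nonzero elements of \<open>L\<close> of absolute value 1, then in a relation
  for some \<open>y\<close> with \<open>v y > 1\<close> the term \<open>c d * y ^ d\<close> would be
  strictly larger than the sum of all others, and the relation could not hold.\<close>

lemma nontrivial_on_base:
  assumes L: "type_subfield L" and alg: "\<And>y. \<exists>d c. (\<forall>k\<le>d. c k \<in> L) \<and> c d \<noteq> 0 \<and> (\<Sum>k\<le>d. c k * y ^ k) = 0"
    and "s \<noteq> 0" "v s \<noteq> 1"
  shows "\<exists>a\<in>L. a \<noteq> 0 \<and> v a \<noteq> 1"
proof (rule ccontr)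
  assume "\<not> ?thesis"
  then have L1: "\<And>a. a \<in> L \<Longrightarrow> a \<noteq> 0 \<Longrightarrow> v a = 1" by auto
  obtain y where y: "1 < v y"
  proof (cases "1 < v s")
    case False
    then have "1 < v (inverse s)" using assms(3,4) v_pos[of s] by (simp add: one_less_inverse_iff)
    then show ?thesis using that by blast
  qed (use that in blast)
  obtain d c where c: "\<And>k. k \<le> d \<Longrightarrow> c k \<in> L" "c d \<noteq> 0" "(\<Sum>k\<le>d. c k * y ^ k) = 0"
    using alg[of y] by blast
  have "(\<Sum>k<d. c k * y ^ k) = - (c d * y ^ d)"
    using c(3) by (simp add: lessThan_Suc_atMost[symmetric] eq_neg_iff_add_eq_0)
  moreover have "v (\<Sum>k<d. c k * y ^ k) < v y ^ d"
  proof (rule v_sum_less)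
    fix k assume k: "k \<in> {..<d}"
    have "v (c k) \<le> 1" using L1[of "c k"] c(1)[of k] k by (cases "c k = 0") auto
    then have "v (c k * y ^ k) \<le> v y ^ k" by (simp add: mult_left_le_one_le)
    also have "\<dots> < v y ^ d" using y k by simp
    finally show "v (c k * y ^ k) < v y ^ d" .
  qed (use y in simp)
  ultimately show False using L1[of "c d"] c(1)[of d] c(2) by simp
qed

text \<open>Dividing the relation by its last coefficient of maximal absolute value makes it monic mod \<open>v < 1\<close>.\<close>

lemma integral_relation:
  assumes L: "type_subfield L" and c: "\<And>k. k \<le> d \<Longrightarrow> c k \<in> L" "c d \<noteq> 0" "(\<Sum>k\<le>d. c k * y ^ k) = 0"
    and y: "v y \<le> 1"
  shows "\<exists>e b. (\<forall>k<e. b k \<in> L \<and> v (b k) \<le> 1) \<and> v (y ^ e - (\<Sum>k<e. b k * y ^ k)) < 1"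
proof -
  define M where "M = Max ((\<lambda>k. v (c k)) ` {..d})"
  have M: "\<And>k. k \<le> d \<Longrightarrow> v (c k) \<le> M" unfolding M_def by auto
  have "M \<in> (\<lambda>k. v (c k)) ` {..d}" unfolding M_def by (rule Max_in) auto
  then have ex: "\<exists>k. k \<le> d \<and> v (c k) = M" by auto
  \<comment> \<open>Taking the last index that attains the maximum makes all later coefficients
    smaller than 1 in absolute value after division by \<open>c e\<close>.\<close>
  define e where "e = (GREATEST k. k \<le> d \<and> v (c k) = M)"
  have e: "e \<le> d" "v (c e) = M"
    using GreatestI_ex_nat[OF ex, of d] unfolding e_def by auto
  have lt: "v (c k) < M" if "e < k" "k \<le> d" for k
    using Greatest_le_nat[of "\<lambda>k. k \<le> d \<and> v (c k) = M" k d] that M[of k] unfolding e_def by force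
  have "0 < M" using M[of d] c(2) v_pos[of "c d"] by simp
  then have ce: "c e \<noteq> 0" using e by auto
  define b where "b k = - (c k / c e)" for k
  have "b k \<in> L" "v (b k) \<le> 1" if "k < e" for k
  proof -
    show "b k \<in> L" unfolding b_def using that e c(1)[of k] c(1)[of e]
        type_subfieldD(3)[OF L] type_subringD(3)[OF type_subfieldD(1)[OF L]] by simp
    show "v (b k) \<le> 1" unfolding b_def using that e M[of k] \<open>0 < M\<close> by simp
  qed
  moreover have "v (y ^ e - (\<Sum>k<e. b k * y ^ k)) < 1"
  proof -
    have "{..d} = {..<e} \<union> {e} \<union> {e<..d}" using e(1) by auto
    then have "(\<Sum>k\<le>d. c k * y ^ k) = (\<Sum>k\<in>{..<e} \<union> {e} \<union> {e<..d}. c k * y ^ k)" by simp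
    also have "\<dots> = (\<Sum>k<e. c k * y ^ k) + c e * y ^ e + (\<Sum>k\<in>{e<..d}. c k * y ^ k)"
      by (subst sum.union_disjoint, force, force, force)+ simp
    finally have "(\<Sum>k<e. c k * y ^ k) + c e * y ^ e + (\<Sum>k\<in>{e<..d}. c k * y ^ k) = 0"
      using c(3) by simp
    then have "(\<Sum>k<e. c k * y ^ k) / c e + y ^ e + (\<Sum>k\<in>{e<..d}. c k * y ^ k) / c e = 0"
      using ce by (simp add: field_simps)
    then have "y ^ e - (\<Sum>k<e. b k * y ^ k) = (\<Sum>k\<in>{e<..d}. b k * y ^ k)"
      unfolding b_def by (simp add: sum_divide_distrib sum_negf eq_neg_iff_add_eq_0 add_ac)
    moreover have "v (\<Sum>k\<in>{e<..d}. b k * y ^ k) < 1"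
    proof (rule v_sum_less)
      fix k assume k: "k \<in> {e<..d}"
      then have "v (b k) < 1" unfolding b_def using lt[of k] e \<open>0 < M\<close> by simp
      then show "v (b k * y ^ k) < 1"
        using y mult_right_le_one_le[of "v (b k)" "v y ^ k"] by (simp add: power_le_one)
    qed simp
    ultimately show ?thesis by simp
  qed
  ultimately show ?thesis by blast
qed

text \<open>The relation for \<open>y ^ e\<close> reduces every power of \<open>y\<close>, modulo
  \<open>v < 1\<close>, to a combination of the powers below \<open>e\<close> with integral
  coefficients from \<open>L\<close>, which are then replaced by finitely many
  representatives.\<close>

lemma residue_finite_powers:
  assumes L: "type_subfield L" and fin: "residue_finite {a \<in> L. v a \<le> 1}" and y: "v y \<le> 1"
    and b: "\<And>k. k < e \<Longrightarrow> b k \<in> L" "\<And>k. k < e \<Longrightarrow> v (b k) \<le> 1" "v (y ^ e - (\<Sum>k<e. b k * y ^ k)) < 1"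
  shows "residue_finite (range (\<lambda>N. y ^ N))"
proof -
  note R = type_subfieldD(1)[OF L]
  \<comment> \<open>For \<open>e = 0\<close> the relation would read \<open>v 1 < 1\<close>.\<close>
  have e: "0 < e" using b(3) by (cases e) auto
  have red: "\<exists>a. (\<forall>k<e. a k \<in> L \<and> v (a k) \<le> 1) \<and> v (y ^ N - (\<Sum>k<e. a k * y ^ k)) < 1" for N
  proof (induction N)
    case 0
    have "(\<Sum>k<e. (if k = 0 then 1 else 0) * y ^ k) = 1"
      using e by (simp add: if_distrib[of "\<lambda>z. z * _"] sum.delta cong: if_cong)
    then show ?case using type_subringD[OF R] by (intro exI[of _ "\<lambda>k. if k = 0 then 1 else 0"]) auto
  next
    case (Suc N)
    then obtain a where a: "\<And>k. k < e \<Longrightarrow> a k \<in> L" "\<And>k. k < e \<Longrightarrow> v (a k) \<le> 1"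
      "v (y ^ N - (\<Sum>k<e. a k * y ^ k)) < 1" by blast
    obtain e' where e': "e = Suc e'" using e by (cases e) auto
    \<comment> \<open>Multiplication by \<open>y\<close> shifts the coefficients up; the overflow
      \<open>a e' * y ^ e\<close> is rewritten by the relation, which adds
      \<open>a e' * b k\<close>.\<close>
    define a' where "a' k = (if k = 0 then 0 else a (k - 1)) + a e' * b k" for k
    have "a' k \<in> L" "v (a' k) \<le> 1" if "k < e" for k
    proof -
      show "a' k \<in> L" unfolding a'_def using that a(1) b(1) e' by (auto intro!: type_subringD[OF R])
      show "v (a' k) \<le> 1" unfolding a'_def using that a(2) b(2) e'
        by (auto intro!: v_add_le mult_le_one)
    qed
    moreover have "v (y ^ Suc N - (\<Sum>k<e. a' k * y ^ k)) < 1"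
    proof -
      have "(\<Sum>k<e. a' k * y ^ k) = (\<Sum>k<e. (if k = 0 then 0 else a (k - 1)) * y ^ k) + a e' * (\<Sum>k<e. b k * y ^ k)"
        unfolding a'_def by (simp add: distrib_right sum.distrib sum_distrib_left mult.assoc)
      also have "(\<Sum>k<e. (if k = 0 then 0 else a (k - 1)) * y ^ k) = (\<Sum>k<e'. a k * y ^ Suc k)"
        unfolding e' by (subst sum.lessThan_Suc_shift) simp
      also have "\<dots> = y * (\<Sum>k<e. a k * y ^ k) - a e' * y ^ e"
        unfolding e' by (simp add: sum_distrib_left algebra_simps)
      finally have "y ^ Suc N - (\<Sum>k<e. a' k * y ^ k) =
          y * (y ^ N - (\<Sum>k<e. a k * y ^ k)) + a e' * (y ^ e - (\<Sum>k<e. b k * y ^ k))"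
        by (simp add: algebra_simps)
      moreover have "v (y * (y ^ N - (\<Sum>k<e. a k * y ^ k))) < 1"
        using y a(3) mult_left_le_one_le[of "v (y ^ N - (\<Sum>k<e. a k * y ^ k))" "v y"] by simp
      moreover have "v (a e' * (y ^ e - (\<Sum>k<e. b k * y ^ k))) < 1"
        using a(2)[of e'] e' b(3) mult_left_le_one_le[of "v (y ^ e - (\<Sum>k<e. b k * y ^ k))" "v (a e')"] by simp
      ultimately show ?thesis by (simp add: v_add_less)
    qed
    ultimately show ?case by blast
  qed
  obtain S where S: "finite S" "\<And>a. a \<in> L \<Longrightarrow> v a \<le> 1 \<Longrightarrow> \<exists>s\<in>S. v (a - s) < 1"
    using fin unfolding residue_finite_def by blast
  let ?S = "(\<lambda>s. \<Sum>k<e. s k * y ^ k) ` (PiE {..<e} (\<lambda>_. S))"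
  have "\<exists>s\<in>?S. v (y ^ N - s) < 1" for N
  proof -
    obtain a where a: "\<And>k. k < e \<Longrightarrow> a k \<in> L" "\<And>k. k < e \<Longrightarrow> v (a k) \<le> 1"
      "v (y ^ N - (\<Sum>k<e. a k * y ^ k)) < 1" using red[of N] by blast
    have "\<forall>k. \<exists>s. k < e \<longrightarrow> s \<in> S \<and> v (a k - s) < 1" using S(2) a(1,2) by blast
    then obtain s where s: "\<And>k. k < e \<Longrightarrow> s k \<in> S" "\<And>k. k < e \<Longrightarrow> v (a k - s k) < 1" by metis
    have "v ((\<Sum>k<e. a k * y ^ k) - (\<Sum>k<e. s k * y ^ k)) < 1"
      unfolding sum_subtractf[symmetric] left_diff_distrib[symmetric]
    proof (rule v_sum_less)
      fix k assume "k \<in> {..<e}"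
      then show "v ((a k - s k) * y ^ k) < 1"
        using y s(2)[of k] mult_right_le_one_le[of "v (a k - s k)" "v y ^ k"] by (simp add: power_le_one)
    qed simp
    then have "v (y ^ N - (\<Sum>k<e. s k * y ^ k)) < 1" using v_diff_trans a(3) by blast
    moreover have mem: "restrict s {..<e} \<in> PiE {..<e} (\<lambda>_. S)" using s(1) by auto
    have "(\<Sum>k<e. s k * y ^ k) \<in> ?S" by (rule image_eqI[OF _ mem]) simp
    ultimately show ?thesis by blast
  qed
  moreover have "finite ?S" by (intro finite_imageI finite_PiE) (use S in auto)
  ultimately show ?thesis unfolding residue_finite_def by (intro exI[of _ ?S]) blast
qed

text \<open>The monomials have finitely many residues, represented by the finite set
  \<open>Mon\<close>. Collecting the terms of a polynomial by the representative of their monomial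
  leaves a combination of \<open>Mon\<close> with coefficients in the finite set
  \<open>F\<close>.\<close>

lemma residue_finite_mpoly_values:
  assumes "finite F" and F: "type_subring F" and y: "\<And>j. j \<le> n \<Longrightarrow> v (y j) \<le> 1"
    and fin: "\<And>j. j \<le> n \<Longrightarrow> residue_finite (range (\<lambda>N. y j ^ N))"
  shows "residue_finite (mpoly_eval y ` mpolys F n)"
proof -
  have "\<forall>j. \<exists>S. j \<le> n \<longrightarrow> finite S \<and> (\<forall>N. \<exists>s\<in>S. v (y j ^ N - s) < 1)"
    using fin unfolding residue_finite_def by (metis rangeI)
  then obtain S where S: "\<And>j. j \<le> n \<Longrightarrow> finite (S j)" "\<And>j N. j \<le> n \<Longrightarrow> \<exists>s\<in>S j. v (y j ^ N - s) < 1"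
    by metis
  define Mon where "Mon = (\<lambda>s. \<Prod>j\<le>n. s j) ` (PiE {..n} S)"
  have finM: "finite Mon" unfolding Mon_def by (intro finite_imageI finite_PiE) (use S in auto)
  have mon: "\<exists>z\<in>Mon. v (monomial_value y m - z) < 1" if m: "Poly_Mapping.keys m \<subseteq> {..n}" for m
  proof -
    have "\<forall>j. \<exists>s. j \<le> n \<longrightarrow> s \<in> S j \<and> v (y j ^ Poly_Mapping.lookup m j - s) < 1" using S(2) by blast
    then obtain s where s: "\<And>j. j \<le> n \<Longrightarrow> s j \<in> S j"
      "\<And>j. j \<le> n \<Longrightarrow> v (y j ^ Poly_Mapping.lookup m j - s j) < 1" by metis
    have "v ((\<Prod>j\<le>n. y j ^ Poly_Mapping.lookup m j) - (\<Prod>j\<le>n. s j)) < 1"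
      using v_prod_less[of "{..n}" "\<lambda>j. y j ^ Poly_Mapping.lookup m j" s] s(2) y
      by (simp add: power_le_one)
    moreover have mem: "restrict s {..n} \<in> PiE {..n} S" using s(1) by auto
    have "(\<Prod>j\<le>n. s j) \<in> Mon" unfolding Mon_def by (rule image_eqI[OF _ mem]) simp
    ultimately show ?thesis
      unfolding monomial_value_superset[OF finite_atMost m] by blast
  qed
  let ?S = "(\<lambda>c. \<Sum>z\<in>Mon. c z * z) ` (PiE Mon (\<lambda>_. F))"
  have "\<exists>s\<in>?S. v (mpoly_eval y f - s) < 1" if f: "f \<in> mpolys F n" for f
  proof -
    have "\<forall>m. \<exists>z. m \<in> Poly_Mapping.keys f \<longrightarrow> z \<in> Mon \<and> v (monomial_value y m - z) < 1"
      using mon f unfolding mpolys_def by blast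
    then obtain z where z: "\<And>m. m \<in> Poly_Mapping.keys f \<Longrightarrow> z m \<in> Mon"
      "\<And>m. m \<in> Poly_Mapping.keys f \<Longrightarrow> v (monomial_value y m - z m) < 1" by metis
    have cF: "Poly_Mapping.lookup f m \<in> F" for m using f unfolding mpolys_def by auto
    have near: "v (mpoly_eval y f - (\<Sum>m\<in>Poly_Mapping.keys f. Poly_Mapping.lookup f m * z m)) < 1"
      unfolding mpoly_eval_def monomial_value_def[symmetric] sum_subtractf[symmetric] right_diff_distrib[symmetric]
    proof (rule v_sum_less)
      fix m assume "m \<in> Poly_Mapping.keys f"
      then show "v (Poly_Mapping.lookup f m * (monomial_value y m - z m)) < 1"
        using z(2)[of m] v_finite_subfield_le[OF assms(1) F cF[of m]]
          mult_left_le_one_le[of "v (monomial_value y m - z m)" "v (Poly_Mapping.lookup f m)"] by simp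
    qed simp
    have group: "(\<Sum>m\<in>Poly_Mapping.keys f. Poly_Mapping.lookup f m * z m) =
        (\<Sum>w\<in>Mon. \<Sum>m\<in>{m\<in>Poly_Mapping.keys f. z m = w}. Poly_Mapping.lookup f m * z m)"
      by (rule sum.group[symmetric]) (use finM z(1) in auto)
    have mem: "restrict (\<lambda>w. \<Sum>m\<in>{m\<in>Poly_Mapping.keys f. z m = w}. Poly_Mapping.lookup f m) Mon \<in> PiE Mon (\<lambda>_. F)"
      using cF by (auto intro!: type_subring_sum[OF F])
    have "(\<Sum>w\<in>Mon. \<Sum>m\<in>{m\<in>Poly_Mapping.keys f. z m = w}. Poly_Mapping.lookup f m * z m) \<in> ?S"
      by (rule image_eqI[OF _ mem]) (simp add: sum_distrib_right)
    then have "(\<Sum>m\<in>Poly_Mapping.keys f. Poly_Mapping.lookup f m * z m) \<in> ?S"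
      by (simp only: group)
    with near show ?thesis by (rule bexI)
  qed
  moreover have "finite ?S" by (intro finite_imageI finite_PiE) (use assms(1) finM in auto)
  ultimately show ?thesis unfolding residue_finite_def by (intro exI[of _ ?S]) blast
qed

end

section \<open>Local rings of closed points and functions regular away from one of them\<close>

lemma smooth_projective_curveD:
  assumes "smooth_projective_curve F n (x :: nat \<Rightarrow> 'k::field)"
  shows "type_subfield F" "\<exists>i\<le>n. x i \<noteq> 0"
    "\<exists>t. \<forall>y. \<not> ring.transcendental (ring_of_type_algebra :: 'k ring)
      (generate_field ring_of_type_algebra (F \<union> {t})) y"
  using assms unfolding smooth_projective_curve_def type_subfield_iff by blast+

text \<open>Primality of \<open>\<mm>\<close> keeps products of denominators outside
  \<open>\<mm>\<close>.\<close>

lemma closed_point_subring: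
  assumes F: "type_subring F" and Q: "Q \<in> closed_points F n x"
  shows "type_subring Q"
proof -
  obtain i \<mm> where i: "i \<le> n" "x i \<noteq> 0" "\<mm> \<in> chart_points F n x i"
    "Q = {a / b | a b. a \<in> chart_ring F n x i \<and> b \<in> chart_ring F n x i \<and> b \<notin> \<mm>}"
    using Q unfolding closed_points_def by blast
  let ?R = "chart_ring F n x i"
  have R: "type_subring ?R" by (rule type_subring_chart_ring[OF F])
  have m: "maximalideal \<mm> (ring_of_type_algebra\<lparr>carrier := ?R\<rparr>)"
    using i(3) unfolding chart_points_def by simp
  note p = maximalideal_restrict_prime[OF R m]
  have Q_I: "a / b \<in> Q" if "a \<in> ?R" "b \<in> ?R" "b \<notin> \<mm>" for a b using that i(4) by blast
  show ?thesis
    unfolding type_subring_def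
  proof (intro conjI ballI)
    show "1 \<in> Q" using Q_I[of 1 1] type_subringD[OF R] p(3) by simp
    fix f g assume fg: "f \<in> Q" "g \<in> Q"
    then obtain a b c d where ab: "f = a / b" "a \<in> ?R" "b \<in> ?R" "b \<notin> \<mm>"
      and cd: "g = c / d" "c \<in> ?R" "d \<in> ?R" "d \<notin> \<mm>" using i(4) by blast
    have bd: "b * d \<notin> \<mm>" "b * d \<in> ?R" using p(4) ab cd type_subringD(6)[OF R] by auto
    have "b \<noteq> 0" "d \<noteq> 0" using ab cd p(1) by auto
    then have "f - g = (a * d - c * b) / (b * d)" using ab cd by (simp add: diff_frac_eq)
    then show "f - g \<in> Q" using Q_I[OF _ bd(2,1)] ab cd type_subringD[OF R] by simp
    have "f * g = (a * c) / (b * d)" using ab cd by simp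
    then show "f * g \<in> Q" using Q_I[OF _ bd(2,1)] ab cd type_subringD[OF R] by simp
  qed
qed

lemma regular_away_from_subring:
  assumes "type_subring F"
  shows "type_subring (regular_away_from F n x P)"
  unfolding type_subring_def regular_away_from_def
  by (auto intro: type_subringD[OF closed_point_subring[OF assms]])

lemma (in nonarch_abs) regular_away_from_discrete:
  assumes "finite F" and C: "smooth_projective_curve F n x" and P: "P = {f. v f \<le> 1}"
    and f: "f \<in> regular_away_from F n x P" and "v f < 1"
  shows "f = 0"
proof -
  have F: "type_subring F" using smooth_projective_curveD(1)[OF C] by (rule type_subfieldD)
  \<comment> \<open>Regularity at \<open>P\<close> itself comes from \<open>v f < 1\<close>.\<close>
  have Q: "f \<in> Q" if "Q \<in> closed_points F n x" for Q
    using that f P \<open>v f < 1\<close> unfolding regular_away_from_def by (cases "Q = P") auto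
  have "f \<in> chart_ring F n x i" if "i \<le> n" "x i \<noteq> 0" for i
  proof (rule mem_if_mem_localizations[OF type_subring_chart_ring[OF F]])
    fix \<mm> assume m: "maximalideal \<mm> (ring_of_type_algebra\<lparr>carrier := chart_ring F n x i\<rparr>)"
    have "{a / b | a b. a \<in> chart_ring F n x i \<and> b \<in> chart_ring F n x i \<and> b \<notin> \<mm>} \<in> closed_points F n x"
      unfolding closed_points_def chart_points_def using that m by blast
    from Q[OF this] show "\<exists>a b. f = a / b \<and> a \<in> chart_ring F n x i \<and> b \<in> chart_ring F n x i \<and> b \<notin> \<mm>"
      by blast
  qed
  then have "f = 0 \<or> (\<exists>k>0. f ^ k = 1)"
    by (rule regular_imp_root_of_unity[OF assms(1) F smooth_projective_curveD(2)[OF C]])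
  then show ?thesis using v_root_of_unity \<open>v f < 1\<close> by fastforce
qed

text \<open>\<open>P\<close> is a localization of a chart ring whose denominators are units of
  \<open>P\<close>, so it is enough to treat the residues of the chart ring. That ring is generated
  over the finite \<open>F\<close> by integral elements, each satisfying an algebraic relation over
  \<open>L\<close>, and \<open>L\<close> consists of rational functions in one element
  \<open>u\<close>. The element \<open>s\<close> certifies that \<open>v\<close> is
  nontrivial.\<close>

lemma (in nonarch_abs) residue_finite_closed_point:
  assumes "finite F" and C: "smooth_projective_curve F n x" and P: "P = {f. v f \<le> 1}"
    and "P \<in> closed_points F n x" and s: "s \<noteq> 0" "v s \<noteq> 1"
  shows "residue_finite P"
proof -
  have F: "type_subfield F" using smooth_projective_curveD(1)[OF C] .
  note FR = type_subfieldD(1)[OF F]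
  obtain t where t: "\<And>y. \<not> ring.transcendental (ring_of_type_algebra :: 'k ring)
      (generate_field ring_of_type_algebra (F \<union> {t})) y"
    using smooth_projective_curveD(3)[OF C] by blast
  define L where "L = generate_field (ring_of_type_algebra :: 'k ring) (F \<union> {t})"
  interpret K: field "ring_of_type_algebra :: 'k ring" by (rule field_from_type_algebra)
  have L: "type_subfield L"
    unfolding L_def type_subfield_iff[symmetric] by (rule K.generate_field_is_subfield) simp
  have alg: "\<exists>d c. (\<forall>k\<le>d. c k \<in> L) \<and> c d \<noteq> 0 \<and> (\<Sum>k\<le>d. c k * y ^ k) = 0" for y
    by (rule not_transcendental_imp_relation[OF type_subfieldD(1)[OF L]]) (use t[of y] in \<open>simp add: L_def\<close>)
  \<comment> \<open>one of \<open>t\<close> and \<open>1 / t\<close> is integral, and both generate the same field\<close>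
  obtain u where u: "v u \<le> 1" "L \<subseteq> fractions_in F u"
  proof (cases "v t \<le> 1")
    case True
    have "t \<in> fractions_in F t"
      by (rule fractions_inI[of "[:0, 1:]" _ "[:1:]"])
        (auto simp: polys_over_def coeff_pCons type_subringD[OF FR] split: nat.split)
    then show ?thesis using that[of t] True generate_field_subset_fractions[OF F] unfolding L_def by blast
  next
    case False
    then have "t \<noteq> 0" by auto
    then have "t \<in> fractions_in F (inverse t)"
      by (intro fractions_inI[of "[:1:]" _ "[:0, 1:]"])
        (auto simp: divide_inverse polys_over_def coeff_pCons type_subringD[OF FR] split: nat.split)
    moreover have "v (inverse t) \<le> 1" using False by (simp add: inverse_le_1_iff)
    ultimately show ?thesis using that[of "inverse t"] generate_field_subset_fractions[OF F] unfolding L_def by blast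
  qed
  obtain a where a: "a \<in> L" "a \<noteq> 0" "v a \<noteq> 1" using nontrivial_on_base[OF L alg s] by blast
  then obtain p r where pr: "p \<in> polys_over F" "r \<in> polys_over F" "poly r u \<noteq> 0" "a = poly p u / poly r u"
    using u(2) unfolding fractions_in_def by blast
  \<comment> \<open>Nontriviality descends from \<open>L\<close> to polynomials: numerator and
    denominator of \<open>a\<close> cannot both have absolute value 1.\<close>
  have "\<exists>p0\<in>polys_over F. poly p0 u \<noteq> 0 \<and> v (poly p0 u) \<noteq> 1"
  proof (rule ccontr)
    assume "\<not> ?thesis"
    then have "v (poly p u) = 1" "v (poly r u) = 1" using pr a by auto
    then show False using a pr by simp
  qed
  then have "residue_finite {a \<in> fractions_in F u. v a \<le> 1}"
    using residue_finite_fractions_in[OF assms(1) F u(1)] by blast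
  then have resL: "residue_finite {a \<in> L. v a \<le> 1}" using u(2) unfolding residue_finite_def by blast
  have pow: "residue_finite (range (\<lambda>N. y ^ N))" if y: "v y \<le> 1" for y
  proof -
    obtain d c where c: "\<And>k. k \<le> d \<Longrightarrow> c k \<in> L" "c d \<noteq> 0" "(\<Sum>k\<le>d. c k * y ^ k) = 0"
      using alg[of y] by blast
    have "\<exists>e b. (\<forall>k<e. b k \<in> L \<and> v (b k) \<le> 1) \<and> v (y ^ e - (\<Sum>k<e. b k * y ^ k)) < 1"
      by (rule integral_relation[OF L _ c(2,3) y]) (rule c(1))
    then obtain e b where b: "\<forall>k<e. b k \<in> L \<and> v (b k) \<le> 1" "v (y ^ e - (\<Sum>k<e. b k * y ^ k)) < 1"
      by (elim exE conjE)
    show ?thesis by (rule residue_finite_powers[of L y e b, OF L resL y]) (use b in auto)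
  qed
  obtain i \<mm> where i: "i \<le> n" "x i \<noteq> 0" "\<mm> \<in> chart_points F n x i"
    "P = {a / b | a b. a \<in> chart_ring F n x i \<and> b \<in> chart_ring F n x i \<and> b \<notin> \<mm>}"
    using assms(4) unfolding closed_points_def by blast
  let ?R = "chart_ring F n x i"
  have R: "type_subring ?R" by (rule type_subring_chart_ring[OF FR])
  have m: "maximalideal \<mm> (ring_of_type_algebra\<lparr>carrier := ?R\<rparr>)"
    using i(3) unfolding chart_points_def by simp
  note p = maximalideal_restrict_prime[OF R m]
  have RP: "v b \<le> 1" if "b \<in> ?R" for b
  proof -
    have "b / 1 \<in> P" using i(4) that p(3) type_subringD(1)[OF R] by blast
    then show ?thesis using P by simp
  qed
  \<comment> \<open>Both \<open>b\<close> and \<open>1 / b\<close> lie in \<open>P\<close>.\<close>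
  have unit: "v b = 1" if b: "b \<in> ?R" "b \<notin> \<mm>" for b
  proof -
    have "1 / b \<in> P" using i(4) b type_subringD(1)[OF R] by blast
    moreover have "b \<noteq> 0" using b p(1) by auto
    ultimately have "1 \<le> v b" using P v_pos[of b] by (simp add: divide_le_eq)
    then show ?thesis using RP[OF b(1)] by simp
  qed
  have "v (chart_coord x i j) \<le> 1" if "j \<le> n" for j
  proof (rule RP)
    have "Poly_Mapping.single (Poly_Mapping.single j 1) 1 \<in> mpolys F n"
      using that type_subringD[OF FR] unfolding mpolys_def by (auto simp: lookup_single when_def)
    moreover have "mpoly_eval (chart_coord x i) (Poly_Mapping.single (Poly_Mapping.single j 1) 1) = chart_coord x i j"
      by (simp add: mpoly_eval_single monomial_value_def)
    ultimately show "chart_coord x i j \<in> ?R" unfolding chart_ring_def by (metis image_eqI)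
  qed
  then have "residue_finite ?R"
    unfolding chart_ring_def using residue_finite_mpoly_values[OF assms(1) FR, of n "chart_coord x i"] pow by blast
  then have "residue_finite {a / b | a b. a \<in> ?R \<and> b \<in> ?R \<and> v b = 1}"
    by (rule residue_finite_fractions) (rule RP)
  moreover have "P \<subseteq> {a / b | a b. a \<in> ?R \<and> b \<in> ?R \<and> v b = 1}"
    unfolding i(4) using unit by blast
  ultimately show ?thesis unfolding residue_finite_def by blast
qed

section \<open>Haar measure and approximation\<close>

lemma nonarch_abs_val_abs:
  assumes "normalized_valuation \<nu>" "2 \<le> q"
  shows "nonarch_abs (val_abs q \<nu>)"
proof
  have m: "\<And>a b. a \<noteq> 0 \<Longrightarrow> b \<noteq> 0 \<Longrightarrow> \<nu> (a * b) = \<nu> a + \<nu> b"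
    and p: "\<And>a b. a \<noteq> 0 \<Longrightarrow> b \<noteq> 0 \<Longrightarrow> a + b \<noteq> 0 \<Longrightarrow> min (\<nu> a) (\<nu> b) \<le> \<nu> (a + b)"
    using assms(1) unfolding normalized_valuation_def by blast+
  show "val_abs q \<nu> 0 = 0" by (simp add: val_abs_def)
  show "0 < val_abs q \<nu> a" if "a \<noteq> 0" for a using that assms(2) by (simp add: val_abs_def)
  show "val_abs q \<nu> (a * b) = val_abs q \<nu> a * val_abs q \<nu> b" for a b
    using m[of a b] assms(2) by (auto simp: val_abs_def simp flip: power_int_add)
  show "val_abs q \<nu> (a + b) \<le> max (val_abs q \<nu> a) (val_abs q \<nu> b)" for a b
  \<comment> \<open>\<open>\<nu> 0\<close> is an arbitrary integer, so the valuation inequality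
    covers only nonzero terms with nonzero sum.\<close>
  proof (cases "a = 0 \<or> b = 0 \<or> a + b = 0")
    case False
    then have "- \<nu> (a + b) \<le> - \<nu> a \<or> - \<nu> (a + b) \<le> - \<nu> b" using p[of a b] by auto
    then have "real q powi (- \<nu> (a + b)) \<le> real q powi (- \<nu> a) \<or> real q powi (- \<nu> (a + b)) \<le> real q powi (- \<nu> b)"
      using assms(2) by (auto intro!: power_int_increasing)
    then show ?thesis using False by (auto simp: val_abs_def)
  next
    case True
    have "0 \<le> val_abs q \<nu> c" for c by (simp add: val_abs_def)
    then show ?thesis using True by (auto simp: val_abs_def max_def)
  qed
qed

lemma haar_measureD:
  assumes "haar_measure \<mu>"
  shows "sets \<mu> = sets borel" "compact C \<Longrightarrow> emeasure \<mu> C < \<infinity>"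
    "B \<in> sets borel \<Longrightarrow> emeasure \<mu> ((+) a ` B) = emeasure \<mu> B"
  using assms unfolding haar_measure_def by auto

text \<open>\<open>residue\<close> records what the curve contributes to the topology of the field.
  The base \<open>q\<close> of the absolute value stays independent of the size of the residue
  field.\<close>

locale local_field =
  fixes q :: nat and \<nu> :: "'c::{field, complete_space} \<Rightarrow> int" and \<pi> :: 'c
  assumes q: "2 \<le> q" and normalized: "normalized_valuation \<nu>"
    and dist_eq: "dist a b = val_abs q \<nu> (a - b)"
    and pi: "\<pi> \<noteq> 0" "\<nu> \<pi> = 1"
    and residue: "nonarch_abs.residue_finite (val_abs q \<nu>) {a. val_abs q \<nu> a \<le> 1}"
begin

sublocale nonarch_abs "val_abs q \<nu>"
  by (rule nonarch_abs_val_abs[OF normalized q])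

abbreviation "absv \<equiv> val_abs q \<nu>"

text \<open>The fractional ideal generated by \<open>\<pi> powi k\<close>, so at once a closed ball
  and an additive group; larger \<open>k\<close> means a smaller ball.\<close>

definition fball :: "int \<Rightarrow> 'c set" where
  "fball k = {a. absv a \<le> real q powi (- k)}"

lemma q_powi_le_iff: "real q powi k \<le> real q powi l \<longleftrightarrow> k \<le> l"
  using q by (metis Suc_1 Suc_le_lessD leD leI of_nat_1 of_nat_less_iff power_int_increasing
    power_int_strict_increasing less_imp_le)

lemma absv_nz: "a \<noteq> 0 \<Longrightarrow> absv a = real q powi (- \<nu> a)"
  by (simp add: val_abs_def)

lemma mem_fball: "a \<in> fball k \<longleftrightarrow> a = 0 \<or> k \<le> \<nu> a"
  unfolding fball_def using absv_nz[of a] q by (cases "a = 0") (auto simp: q_powi_le_iff)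

lemma fball_zero [simp]: "0 \<in> fball k"
  by (simp add: mem_fball)

lemma fball_add: "a \<in> fball k \<Longrightarrow> b \<in> fball k \<Longrightarrow> a + b \<in> fball k"
  unfolding fball_def by (auto intro: v_add_le)

lemma fball_minus: "a \<in> fball k \<Longrightarrow> - a \<in> fball k"
  unfolding fball_def by auto

lemma fball_diff: "a \<in> fball k \<Longrightarrow> b \<in> fball k \<Longrightarrow> a - b \<in> fball k"
  using fball_add[of a k "- b"] fball_minus by simp

lemma fball_mono: "k \<le> l \<Longrightarrow> fball l \<subseteq> fball k"
  by (auto simp: mem_fball)

text \<open>Nonzero absolute values are integral powers of \<open>q\<close>, so none lies strictly
  between \<open>1 / q\<close> and 1.\<close>

lemma fball_1_iff: "a \<in> fball 1 \<longleftrightarrow> absv a < 1"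
proof (cases "a = 0")
  case False
  then show ?thesis using q_powi_le_iff[of 0 "- \<nu> a"] absv_nz[OF False] by (auto simp: mem_fball not_le[symmetric])
qed simp

lemma fball_0_iff: "a \<in> fball 0 \<longleftrightarrow> absv a \<le> 1"
  by (simp add: fball_def)

lemma absv_pi_powi: "absv (\<pi> powi k) = real q powi (- k)"
proof (cases "0 \<le> k")
  case True
  then show ?thesis using absv_nz[OF pi(1)] pi(2) q
    by (simp add: power_int_def power_inverse)
next
  case False
  then show ?thesis using absv_nz[OF pi(1)] pi(2) q
    by (simp add: power_int_def power_inverse)
qed

lemma fball_scale: "\<pi> powi l * a \<in> fball (k + l) \<longleftrightarrow> a \<in> fball k"
proof -
  have "real q powi (- (k + l)) = real q powi (- l) * real q powi (- k)"
    unfolding minus_add by (rule power_int_add) (use q in simp)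
  then show ?thesis unfolding fball_def using q by (simp add: absv_pi_powi)
qed

lemma translate_fball: "(+) t ` fball k = cball t (real q powi (- k))"
proof -
  have "a \<in> (+) t ` fball k \<longleftrightarrow> a \<in> cball t (real q powi (- k))" for a
  proof
    assume "a \<in> cball t (real q powi (- k))"
    then have "a - t \<in> fball k" unfolding fball_def by (simp add: dist_eq v_minus_commute)
    then show "a \<in> (+) t ` fball k" by (rule image_eqI[rotated]) simp
  qed (auto simp: dist_eq fball_def)
  then show ?thesis by blast
qed

lemma fball_eq_cball: "fball k = cball 0 (real q powi (- k))"
  using translate_fball[of 0 k] by simp

section \<open>Coset representatives of balls\<close>

definition transversal :: "'c set \<Rightarrow> int \<Rightarrow> int \<Rightarrow> bool" where
  "transversal T k l \<longleftrightarrow> finite T \<and> T \<subseteq> fball k \<and> (\<forall>a\<in>fball k. \<exists>t\<in>T. a - t \<in> fball l) \<and>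
     (\<forall>s\<in>T. \<forall>t\<in>T. s - t \<in> fball l \<longrightarrow> s = t)"

text \<open>The representatives provided by \<open>residue\<close> may be redundant or lie outside
  \<open>fball 0\<close>. Choosing one element in each coset of \<open>fball 1\<close> makes the
  system exact, as the computation of measures demands.\<close>

lemma ex_residue_transversal: "\<exists>T. transversal T 0 1"
proof -
  obtain S where S: "finite S" "\<And>a. a \<in> fball 0 \<Longrightarrow> \<exists>s\<in>S. a - s \<in> fball 1"
    using residue unfolding residue_finite_def by (auto simp: fball_0_iff fball_1_iff)
  define C where "C a = {b. b - a \<in> fball 1}" for a
  have C_eq: "C a = C b" if "a - b \<in> fball 1" for a b
    using fball_add[OF _ that] fball_diff[OF _ that] unfolding C_def by force
  have "C ` fball 0 \<subseteq> C ` S" using S(2) C_eq by blast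
  then have finC: "finite (C ` fball 0)" using S(1) finite_surj by blast
  define T where "T = (\<lambda>Y. SOME t. t \<in> Y) ` (C ` fball 0)"
  have rep: "(SOME t. t \<in> C a) \<in> C a" for a
    by (rule someI[of _ a]) (simp add: C_def)
  have "transversal T 0 1"
    unfolding transversal_def
  proof (intro conjI ballI impI)
    show "finite T" unfolding T_def using finC by simp
    show "T \<subseteq> fball 0"
    proof
      fix t assume "t \<in> T"
      then obtain a where a: "a \<in> fball 0" "t \<in> C a" unfolding T_def using rep by blast
      then have "t - a \<in> fball 0" using fball_mono[of 0 1] unfolding C_def by auto
      then show "t \<in> fball 0" using fball_add[OF _ a(1)] by force
    qed
    fix a assume "a \<in> fball 0"
    then show "\<exists>t\<in>T. a - t \<in> fball 1"
      unfolding T_def using rep[of a] fball_minus[of "(SOME t. t \<in> C a) - a" 1]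
      by (auto simp: C_def)
  next
    fix s t assume "s \<in> T" "t \<in> T" and st: "s - t \<in> fball 1"
    then obtain a b where ab: "s = (SOME t. t \<in> C a)" "t = (SOME t. t \<in> C b)" unfolding T_def by blast
    then have "C s = C a" "C t = C b" using C_eq rep unfolding C_def by blast+
    then show "s = t" using C_eq[OF st] ab by simp
  qed
  then show ?thesis ..
qed

definition residue_reps :: "'c set" where "residue_reps = (SOME T. transversal T 0 1)"

definition Q :: nat where "Q = card residue_reps"

lemma residue_reps: "transversal residue_reps 0 1"
  unfolding residue_reps_def using ex_residue_transversal by (rule someI_ex)

text \<open>The residues of 0 and 1 differ. This is what makes the measures of shrinking balls tend
  to 0.\<close>

lemma Q_ge_2: "2 \<le> Q"
proof -
  obtain s t where st: "s \<in> residue_reps" "0 - s \<in> fball 1" "t \<in> residue_reps" "1 - t \<in> fball 1"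
    using residue_reps unfolding transversal_def by (metis fball_0_iff v_zero v_one zero_le_one order_refl)
  have "s \<noteq> t"
  proof
    assume "s = t"
    then have "1 \<in> fball 1" using fball_diff[OF st(4,2)] by simp
    then show False by (simp add: fball_1_iff)
  qed
  then have "card {s, t} \<le> card residue_reps"
    using st residue_reps unfolding transversal_def by (intro card_mono) auto
  then show ?thesis using \<open>s \<noteq> t\<close> unfolding Q_def by simp
qed

text \<open>Each step adds one digit of the expansion in powers of \<open>\<pi>\<close>: a coset of
  \<open>fball (k + int j)\<close> splits according to the residue \<open>s\<close> that multiplies
  \<open>\<pi> powi (k + int j)\<close>.\<close>

lemma ex_transversal: "\<exists>T. transversal T k (k + int j) \<and> card T = Q ^ j"
proof (induction j)
  case 0
  have "transversal {0} k k" unfolding transversal_def by simp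
  then show ?case by (intro exI[of _ "{0}"]) simp
next
  case (Suc j)
  then obtain T where T: "transversal T k (k + int j)" "card T = Q ^ j" by blast
  let ?p = "\<pi> powi (k + int j)"
  let ?h = "\<lambda>(t, s). t + ?p * s"
  have scale: "?p * a \<in> fball (k + int (Suc j)) \<longleftrightarrow> a \<in> fball 1" for a
    using fball_scale[of "k + int j" a 1] by (simp add: add_ac)
  have scale0: "?p * a \<in> fball (k + int j) \<longleftrightarrow> a \<in> fball 0" for a
    using fball_scale[of "k + int j" a 0] by simp
  have residue_reps_integral: "\<And>s. s \<in> residue_reps \<Longrightarrow> s \<in> fball 0" using residue_reps unfolding transversal_def by auto
  \<comment> \<open>Modulo \<open>fball (k + int j)\<close> the new digits disappear, which gives
    \<open>t = t'\<close>; division by \<open>?p\<close> then compares the digits.\<close>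
  have uniq: "t = t' \<and> s = s'"
    if h: "t \<in> T" "t' \<in> T" "s \<in> residue_reps" "s' \<in> residue_reps" "(t + ?p * s) - (t' + ?p * s') \<in> fball (k + int (Suc j))" for t t' s s'
  proof -
    have "?p * (s - s') \<in> fball (k + int j)"
      unfolding scale0 using residue_reps_integral h fball_diff by blast
    moreover have "(t + ?p * s) - (t' + ?p * s') \<in> fball (k + int j)"
      using h(5) fball_mono[of "k + int j" "k + int (Suc j)"] by auto
    ultimately have "((t + ?p * s) - (t' + ?p * s')) - ?p * (s - s') \<in> fball (k + int j)"
      by (rule fball_diff[rotated])
    then have "t - t' \<in> fball (k + int j)" by (simp add: algebra_simps)
    then have t: "t = t'" using T(1) h unfolding transversal_def by blast
    then have "?p * (s - s') \<in> fball (k + int (Suc j))" using h(5) by (simp add: algebra_simps)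
    then have "s - s' \<in> fball 1" unfolding scale .
    then show ?thesis using t residue_reps h unfolding transversal_def by blast
  qed
  have inj: "inj_on ?h (T \<times> residue_reps)"
    using uniq by (auto simp: inj_on_def)
  have "transversal (?h ` (T \<times> residue_reps)) k (k + int (Suc j))"
    unfolding transversal_def
  proof (intro conjI ballI impI)
    show "finite (?h ` (T \<times> residue_reps))" using T(1) residue_reps unfolding transversal_def by auto
    show "?h ` (T \<times> residue_reps) \<subseteq> fball k"
    proof clarify
      fix t s assume "t \<in> T" "s \<in> residue_reps"
      moreover have "?p * s \<in> fball k"
        using \<open>s \<in> residue_reps\<close> residue_reps_integral scale0 fball_mono[of k "k + int j"] by auto
      ultimately show "t + ?p * s \<in> fball k" using T(1) unfolding transversal_def by (auto intro: fball_add)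
    qed
    fix a assume "a \<in> fball k"
    then obtain t where t: "t \<in> T" "a - t \<in> fball (k + int j)" using T(1) unfolding transversal_def by blast
    then have "(a - t) / ?p \<in> fball 0" using scale0[of "(a - t) / ?p"] pi(1) by simp
    then obtain s where s: "s \<in> residue_reps" "(a - t) / ?p - s \<in> fball 1" using residue_reps unfolding transversal_def by blast
    then have "?p * ((a - t) / ?p - s) \<in> fball (k + int (Suc j))" unfolding scale by blast
    moreover have "?p * ((a - t) / ?p - s) = a - (t + ?p * s)"
    proof -
      have "?p * ((a - t) / ?p) = a - t" using pi(1) by simp
      then show ?thesis unfolding right_diff_distrib[of ?p "(a - t) / ?p" s] by (simp only: diff_diff_add)
    qed
    ultimately have "a - (t + ?p * s) \<in> fball (k + int (Suc j))" by simp
    then show "\<exists>u\<in>?h ` (T \<times> residue_reps). a - u \<in> fball (k + int (Suc j))"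
      using t(1) s(1) by (intro bexI[of _ "?h (t, s)"] imageI) auto
  next
    fix u w assume "u \<in> ?h ` (T \<times> residue_reps)" "w \<in> ?h ` (T \<times> residue_reps)" "u - w \<in> fball (k + int (Suc j))"
    then show "u = w" using uniq by auto
  qed
  moreover have "card (?h ` (T \<times> residue_reps)) = Q ^ Suc j"
    using inj T(2) by (simp add: card_image card_cartesian_product Q_def)
  ultimately show ?case by blast
qed

lemma transversal_cover:
  assumes "transversal T k l" "k \<le> l"
  shows "fball k = (\<Union>t\<in>T. (+) t ` fball l)" "disjoint_family_on (\<lambda>t. (+) t ` fball l) T"
proof -
  have "a \<in> fball k" if "t \<in> T" "a \<in> (+) t ` fball l" for a t
    using that assms(1) fball_mono[OF assms(2)] unfolding transversal_def by (auto intro!: fball_add)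
  moreover have "a \<in> (\<Union>t\<in>T. (+) t ` fball l)" if "a \<in> fball k" for a
  proof -
    obtain t where t: "t \<in> T" "a - t \<in> fball l" using assms(1) \<open>a \<in> fball k\<close> unfolding transversal_def by blast
    have "a \<in> (+) t ` fball l" by (rule image_eqI[OF _ t(2)]) simp
    with t(1) show ?thesis by (rule UN_I)
  qed
  ultimately show "fball k = (\<Union>t\<in>T. (+) t ` fball l)" by blast
  have "s = t" if "s \<in> T" "t \<in> T" "a \<in> (+) s ` fball l" "a \<in> (+) t ` fball l" for a s t
  proof -
    obtain b c where bc: "b \<in> fball l" "c \<in> fball l" "a = s + b" "a = t + c"
      using \<open>a \<in> (+) s ` fball l\<close> \<open>a \<in> (+) t ` fball l\<close> by (elim imageE)
    then have "s - t = c - b" by (simp add: algebra_simps)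
    then have "s - t \<in> fball l" using fball_diff[OF bc(2,1)] by simp
    then show ?thesis using assms(1) that unfolding transversal_def by blast
  qed
  then show "disjoint_family_on (\<lambda>t. (+) t ` fball l) T"
    unfolding disjoint_family_on_def by blast
qed

section \<open>Compactness and Haar measure of balls\<close>

lemma tendsto_q_powi: "(\<lambda>j. real q powi (- int j)) \<longlonglongrightarrow> 0"
proof -
  have "(\<lambda>j. inverse (real q) ^ j) \<longlonglongrightarrow> 0"
    using q by (intro LIMSEQ_power_zero) (auto simp: inverse_less_1_iff)
  then show ?thesis by (simp add: power_int_minus power_inverse)
qed

text \<open>Closed in a complete space, and covered by finitely many cosets of any given radius.
  Through this a Haar measure, finite on compact sets, is finite on balls.\<close>

lemma compact_fball: "compact (fball k)"
  unfolding compact_eq_totally_bounded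
proof (intro conjI allI impI)
  show "complete (fball k)" unfolding fball_eq_cball by (simp add: complete_eq_closed)
  fix \<epsilon> :: real assume e: "0 < \<epsilon>"
  then have "0 < \<epsilon> * real q powi k" using q by simp
  then obtain j where j: "real q powi (- int j) < \<epsilon> * real q powi k"
    using order_tendstoD(2)[OF tendsto_q_powi] by (metis eventually_sequentially order_refl)
  obtain T where T: "transversal T k (k + int j)" using ex_transversal by blast
  have "- (k + int j) = - int j - k" by simp
  then have "real q powi (- (k + int j)) = real q powi (- int j - k)" by (rule arg_cong)
  also have "\<dots> = real q powi (- int j) / real q powi k"
    by (rule power_int_diff) (use q in simp)
  also have "\<dots> < \<epsilon>" using j q by (simp add: divide_less_eq)
  finally have ball: "cball t (real q powi (- (k + int j))) \<subseteq> ball t \<epsilon>" for t :: 'c by auto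
  have "fball k = (\<Union>t\<in>T. cball t (real q powi (- (k + int j))))"
    using transversal_cover(1)[OF T] by (simp add: translate_fball)
  also have "\<dots> \<subseteq> (\<Union>t\<in>T. ball t \<epsilon>)" by (rule UN_mono[OF order_refl ball])
  finally have "fball k \<subseteq> (\<Union>t\<in>T. ball t \<epsilon>)" .
  then show "\<exists>T. finite T \<and> fball k \<subseteq> (\<Union>t\<in>T. ball t \<epsilon>)"
    using T unfolding transversal_def by blast
qed

lemma emeasure_fball_finite: "haar_measure \<mu> \<Longrightarrow> emeasure \<mu> (fball k) < \<infinity>"
  using haar_measureD(2)[of \<mu>] compact_fball by blast

lemma measure_cball:
  assumes "haar_measure \<mu>"
  shows "measure \<mu> (cball t (real q powi (- k))) = measure \<mu> (fball k)"
    "emeasure \<mu> (cball t (real q powi (- k))) < \<infinity>"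
proof -
  have "emeasure \<mu> ((+) t ` fball k) = emeasure \<mu> (fball k)"
    by (rule haar_measureD(3)[OF assms]) (simp add: fball_eq_cball)
  then show "measure \<mu> (cball t (real q powi (- k))) = measure \<mu> (fball k)"
    "emeasure \<mu> (cball t (real q powi (- k))) < \<infinity>"
    using emeasure_fball_finite[OF assms, of k] unfolding translate_fball measure_def by simp_all
qed

text \<open>The larger ball is a disjoint union of \<open>Q ^ j\<close> translates of the smaller
  one, of equal measure by invariance.\<close>

lemma measure_fball_split:
  assumes "haar_measure \<mu>"
  shows "measure \<mu> (fball k) = real Q ^ j * measure \<mu> (fball (k + int j))"
proof -
  obtain T where T: "transversal T k (k + int j)" "card T = Q ^ j" using ex_transversal by blast
  note cov = transversal_cover[OF T(1), simplified]
  have fin: "finite T" using T(1) unfolding transversal_def by simp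
  have "measure \<mu> (fball k) = measure \<mu> (\<Union>t\<in>T. (+) t ` fball (k + int j))"
    using cov(1) by simp
  also have "\<dots> = (\<Sum>t\<in>T. measure \<mu> ((+) t ` fball (k + int j)))"
    using measure_cball(2)[OF assms, of _ "k + int j"] haar_measureD(1)[OF assms] cov(2) fin
    by (intro measure_finite_Union) (auto simp: translate_fball less_top)
  also have "\<dots> = real Q ^ j * measure \<mu> (fball (k + int j))"
    unfolding translate_fball measure_cball(1)[OF assms] using T(2) by simp
  finally show ?thesis .
qed

lemma measure_fball:
  assumes "haar_measure \<mu>"
  shows "measure \<mu> (fball k) = measure \<mu> (fball 0) * real Q powi (- k)"
proof (cases "0 \<le> k")
  case True
  then have k: "k = int (nat k)" by simp
  have "real Q powi (- k) = inverse (real Q ^ nat k)" by (subst k) (simp only: power_int_minus power_int_of_nat)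
  moreover have "measure \<mu> (fball 0) = real Q ^ nat k * measure \<mu> (fball k)"
    using measure_fball_split[OF assms, of 0 "nat k"] True by simp
  ultimately show ?thesis using Q_ge_2 by simp
next
  case False
  then have k: "- k = int (nat (- k))" by simp
  have "real Q powi (- k) = real Q ^ nat (- k)" by (subst k) (simp only: power_int_of_nat)
  moreover have "measure \<mu> (fball k) = real Q ^ nat (- k) * measure \<mu> (fball 0)"
    using measure_fball_split[OF assms, of k "nat (- k)"] False by simp
  ultimately show ?thesis by simp
qed

text \<open>The balls around \<open>z\<close> have measure tending to 0. This later discards the
  fractions themselves.\<close>

lemma singleton_null:
  fixes z :: 'c
  assumes "haar_measure \<mu>"
  shows "{z} \<in> null_sets \<mu>"
proof -
  have sets: "{z} \<in> sets \<mu>" unfolding haar_measureD(1)[OF assms] by (rule borel_closed) simp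
  have fin: "emeasure \<mu> {z} < \<infinity>" using haar_measureD(2)[OF assms] by simp
  have "measure \<mu> {z} \<le> measure \<mu> (fball 0) * inverse (real Q) ^ j" for j
  proof -
    have "measure \<mu> {z} \<le> measure \<mu> (cball z (real q powi (- int j)))"
      using measure_cball(2)[OF assms] sets haar_measureD(1)[OF assms]
      by (intro measure_mono_fmeasurable) (auto simp: fmeasurable_def)
    also have "\<dots> = measure \<mu> (fball 0) * inverse (real Q) ^ j"
      unfolding measure_cball(1)[OF assms] measure_fball[OF assms, of "int j"]
      by (simp add: power_int_minus power_inverse)
    finally show ?thesis .
  qed
  moreover have "(\<lambda>j. measure \<mu> (fball 0) * inverse (real Q) ^ j) \<longlonglongrightarrow> measure \<mu> (fball 0) * 0"
    using Q_ge_2 by (intro tendsto_intros LIMSEQ_power_zero) (auto simp: inverse_less_1_iff)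
  ultimately have "measure \<mu> {z} \<le> measure \<mu> (fball 0) * 0"
    by (intro LIMSEQ_le_const) auto
  then have "measure \<mu> {z} = 0" by (simp add: measure_le_0_iff)
  then have "emeasure \<mu> {z} = 0" using fin by (simp add: emeasure_eq_ennreal_measure less_top)
  then show ?thesis using sets by auto
qed

text \<open>Elements of \<open>A\<close> in the same coset of \<open>fball 1\<close> differ by an
  element of \<open>A\<close> of absolute value below 1, hence coincide. Between
  \<open>- int r\<close> and 1 there are \<open>Suc r\<close> digits, whence the exponent.\<close>

lemma discrete_count:
  assumes "\<And>a b. a \<in> A \<Longrightarrow> b \<in> A \<Longrightarrow> a - b \<in> A" "\<And>a. a \<in> A \<Longrightarrow> absv a < 1 \<Longrightarrow> a = 0"
  shows "finite (A \<inter> fball (- int r))" "card (A \<inter> fball (- int r)) \<le> Q ^ Suc r"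
proof -
  obtain T where T: "transversal T (- int r) (- int r + int (Suc r))" "card T = Q ^ Suc r"
    using ex_transversal by blast
  then have fin: "finite T" and T': "\<forall>a\<in>fball (- int r). \<exists>t\<in>T. a - t \<in> fball 1"
    unfolding transversal_def by auto
  obtain h where h: "\<And>a. a \<in> fball (- int r) \<Longrightarrow> h a \<in> T" "\<And>a. a \<in> fball (- int r) \<Longrightarrow> a - h a \<in> fball 1"
    using T' by metis
  have inj: "inj_on h (A \<inter> fball (- int r))"
  proof (rule inj_onI)
    fix a b assume ab: "a \<in> A \<inter> fball (- int r)" "b \<in> A \<inter> fball (- int r)" "h a = h b"
    then have "(a - h a) - (b - h b) \<in> fball 1" using h(2) fball_diff by blast
    then have "a - b \<in> fball 1" using ab(3) by simp
    then have "a - b = 0" using assms ab unfolding fball_1_iff by blast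
    then show "a = b" by simp
  qed
  have im: "h ` (A \<inter> fball (- int r)) \<subseteq> T" using h(1) by auto
  show "finite (A \<inter> fball (- int r))" using inj im fin finite_imageD finite_subset by blast
  show "card (A \<inter> fball (- int r)) \<le> Q ^ Suc r" using card_inj_on_le[OF inj im fin] T(2) by simp
qed

text \<open>
  All denominators of absolute value \<open>q\<^sup>r\<close> and numerators of at most this absolute value contribute at most
  \<open>Q\<^bsup>2r+2\<^esup>\<close> balls, each of measure of order \<open>Q\<^bsup>-M-\<rho>r\<^esup>\<close>. As \<open>\<rho> > 2\<close>, the total measure is summable over \<open>r\<close>.
\<close>

lemma well_approximable_null:
  assumes haar: "haar_measure \<mu>" and "2 < \<rho>"
    and A: "\<And>a b. a \<in> A \<Longrightarrow> b \<in> A \<Longrightarrow> a - b \<in> A" "\<And>a. a \<in> A \<Longrightarrow> absv a < 1 \<Longrightarrow> a = 0"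
  shows "{\<alpha>. absv \<alpha> \<le> 1 \<and> (\<exists>f g. (\<forall>k::nat. f k \<in> A \<and> g k \<in> A \<and> g k \<noteq> 0) \<and>
      (\<lambda>k. f k / g k) \<longlonglongrightarrow> \<alpha> \<and>
      (\<forall>k. absv (\<alpha> - f k / g k) < absv \<pi> powi M / absv (g k) powr \<rho>))} \<in> null_sets \<mu>"
    (is "?Phi \<in> _")
proof -
  define \<delta> where "\<delta> g = absv \<pi> powi M / absv g powr \<rho>" for g
  have \<delta>_pos: "0 < \<delta> g" if "g \<noteq> 0" for g
    using that pi(1) unfolding \<delta>_def by (simp add: v_pos)
  \<comment> \<open>The sequence is traded for one approximation per \<epsilon>, the form that both
    measurability and the covering argument use.\<close>
  have Phi: "\<alpha> \<in> ?Phi \<longleftrightarrow> absv \<alpha> \<le> 1 \<and>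
      (\<forall>\<epsilon>>0. \<exists>f\<in>A. \<exists>g\<in>A - {0}. dist \<alpha> (f / g) < \<epsilon> \<and> dist \<alpha> (f / g) < \<delta> g)" (is "_ \<longleftrightarrow> ?R \<alpha>") for \<alpha>
  proof
    assume "\<alpha> \<in> ?Phi"
    then obtain f g where \<alpha>: "absv \<alpha> \<le> 1" and fg: "\<And>k::nat. f k \<in> A" "\<And>k. g k \<in> A" "\<And>k. g k \<noteq> 0"
      "(\<lambda>k. f k / g k) \<longlonglongrightarrow> \<alpha>" "\<And>k. dist \<alpha> (f k / g k) < \<delta> (g k)"
      unfolding \<delta>_def dist_eq by auto
    have "\<exists>f\<in>A. \<exists>g\<in>A - {0}. dist \<alpha> (f / g) < \<epsilon> \<and> dist \<alpha> (f / g) < \<delta> g" if \<epsilon>: "0 < \<epsilon>" for \<epsilon>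
    proof -
      obtain k where "dist (f k / g k) \<alpha> < \<epsilon>"
        using eventually_happens'[OF sequentially_bot tendstoD[OF fg(4) \<epsilon>]] by (elim exE)
      then have "dist \<alpha> (f k / g k) < \<epsilon>" by (simp add: dist_commute)
      then show ?thesis
        using fg(1)[of k] fg(2)[of k] fg(3)[of k] fg(5)[of k]
        by (intro bexI[of _ "f k"] bexI[of _ "g k"]) simp_all
    qed
    then show "?R \<alpha>" using \<alpha> by simp
  next
    assume R: "?R \<alpha>"
    then have "\<forall>k::nat. \<exists>f g. f \<in> A \<and> g \<in> A \<and> g \<noteq> 0 \<and> dist \<alpha> (f / g) < inverse (real (Suc k)) \<and> dist \<alpha> (f / g) < \<delta> g"
      by (metis Diff_iff insertI1 inverse_positive_iff_positive of_nat_0_less_iff zero_less_Suc)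
    then obtain f g where fg: "\<And>k::nat. f k \<in> A" "\<And>k. g k \<in> A" "\<And>k. g k \<noteq> 0"
      "\<And>k. dist \<alpha> (f k / g k) < inverse (real (Suc k))" "\<And>k. dist \<alpha> (f k / g k) < \<delta> (g k)"
      by metis
    have "(\<lambda>k. f k / g k) \<longlonglongrightarrow> \<alpha>"
    proof (rule metric_tendsto_imp_tendsto[OF LIMSEQ_inverse_real_of_nat])
      show "\<forall>\<^sub>F k in sequentially. dist (f k / g k) \<alpha> \<le> dist (inverse (real (Suc k))) 0"
        using fg(4) by (intro always_eventually allI) (simp add: dist_commute less_imp_le)
    qed
    then show "\<alpha> \<in> ?Phi" using R fg unfolding \<delta>_def dist_eq by blast
  qed
  \<comment> \<open>For each \<open>m\<close> the union of the balls is open, however many fractions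
    there are, so \<open>?Phi\<close> is a closed ball intersected with countably many open
    sets.\<close>
  have sets: "?Phi \<in> sets \<mu>"
  proof -
    have "?Phi = fball 0 \<inter> (\<Inter>m::nat. \<Union>f\<in>A. \<Union>g\<in>A - {0}. ball (f / g) (min (inverse (real (Suc m))) (\<delta> g)))"
      (is "_ = ?G")
    proof (rule Set.set_eqI)
      fix \<alpha>
      have "(\<forall>\<epsilon>>0. \<exists>f\<in>A. \<exists>g\<in>A - {0}. dist \<alpha> (f / g) < \<epsilon> \<and> dist \<alpha> (f / g) < \<delta> g) \<longleftrightarrow>
          (\<forall>m. \<exists>f\<in>A. \<exists>g\<in>A - {0}. dist \<alpha> (f / g) < inverse (real (Suc m)) \<and> dist \<alpha> (f / g) < \<delta> g)"
        (is "?l \<longleftrightarrow> ?r")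
      proof
        assume l: ?l
        show ?r
        proof
          fix m :: nat
          show "\<exists>f\<in>A. \<exists>g\<in>A - {0}. dist \<alpha> (f / g) < inverse (real (Suc m)) \<and> dist \<alpha> (f / g) < \<delta> g"
            by (rule l[rule_format]) simp
        qed
      next
        assume r: ?r
        show ?l
        proof (intro allI impI)
          fix \<epsilon> :: real assume "0 < \<epsilon>"
          then obtain m where "inverse (real (Suc m)) < \<epsilon>" using reals_Archimedean by blast
          moreover obtain f g where "f \<in> A" "g \<in> A - {0}" "dist \<alpha> (f / g) < inverse (real (Suc m))"
            "dist \<alpha> (f / g) < \<delta> g" using r by (elim allE[of _ m] bexE conjE)
          ultimately show "\<exists>f\<in>A. \<exists>g\<in>A - {0}. dist \<alpha> (f / g) < \<epsilon> \<and> dist \<alpha> (f / g) < \<delta> g"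
            by (intro bexI[of _ f] bexI[of _ g]) simp_all
        qed
      qed
      then show "\<alpha> \<in> ?Phi \<longleftrightarrow> \<alpha> \<in> ?G"
        unfolding Phi by (simp add: fball_0_iff dist_commute)
    qed
    also have "\<dots> \<in> sets borel"
      unfolding fball_eq_cball
      by (intro sets.Int sets.countable_INT'' borel_closed closed_cball borel_open open_UN ballI open_ball) auto
    finally show ?thesis using haar_measureD(1)[OF haar] by simp
  qed
  define B where "B r = A \<inter> fball (- int r)" for r
  have finB: "finite (B r)" and cardB: "card (B r) \<le> Q ^ Suc r" for r
    unfolding B_def using discrete_count[of A r] A by blast+
  \<comment> \<open>Pairs with \<open>g = 0\<close> are included; as \<open>f / 0 = 0\<close>, they
    add at most the center 0.\<close>
  define Z where "Z r = (\<lambda>(f, g). f / g) ` (B r \<times> B r)" for r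
  have finZ: "finite (Z r)" for r unfolding Z_def using finB by simp
  have cardZ: "card (Z r) \<le> Q ^ (2 * r + 2)" for r
  proof -
    have "card (Z r) \<le> card (B r) * card (B r)"
      unfolding Z_def using card_image_le[of "B r \<times> B r"] finB by (simp add: card_cartesian_product)
    also have "\<dots> \<le> Q ^ Suc r * Q ^ Suc r" by (intro mult_le_mono cardB)
    also have "\<dots> = Q ^ (2 * r + 2)" by (simp flip: power_add add: mult_2)
    finally show ?thesis .
  qed
  \<comment> \<open>With \<open>\<nu> g = - r\<close> the inequality says
    \<open>\<nu> (\<alpha> - f / g) > M + \<rho> * r\<close>; an integer above this bound is at
    least its ceiling.\<close>
  define e where "e r = \<lceil>real_of_int M + \<rho> * real r\<rceil>" for r
  define E where "E r = (\<Union>z\<in>Z r. cball z (real q powi (- e r)))" for r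
  have fm: "cball z (real q powi (- k)) \<in> fmeasurable \<mu>" for z k
    using measure_cball(2)[OF haar] haar_measureD(1)[OF haar] unfolding fmeasurable_def by simp
  have Efm: "E r \<in> fmeasurable \<mu>" for r
    unfolding E_def by (intro fmeasurable.finite_UN finZ fm)
  \<comment> \<open>At most \<open>Q ^ (2 * r + 2)\<close> balls, each of measure at most
    \<open>Q powr (- (M + \<rho> * r))\<close> times that of \<open>fball 0\<close>: the factors
    free of \<open>r\<close> go into \<open>c\<close>, the others form \<open>s ^ r\<close>.\<close>
  define c where "c = measure \<mu> (fball 0) * real Q ^ 2 * real Q powr (- real_of_int M)"
  define s where "s = real Q powr (2 - \<rho>)"
  have "1 < real Q" using Q_ge_2 by simp
  have s: "0 \<le> s" "s < 1" unfolding s_def using \<open>1 < real Q\<close> \<open>2 < \<rho>\<close> by (auto simp: powr_less_one)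
  have Em: "measure \<mu> (E r) \<le> c * s ^ r" for r
  proof -
    have "measure \<mu> (E r) \<le> (\<Sum>z\<in>Z r. measure \<mu> (cball z (real q powi (- e r))))"
      unfolding E_def by (intro measure_UNION_le finZ fmeasurableD fm)
    also have "\<dots> = real (card (Z r)) * measure \<mu> (fball (e r))"
      unfolding measure_cball(1)[OF haar] by simp
    also have "\<dots> \<le> real Q ^ (2 * r + 2) * (measure \<mu> (fball 0) * real Q powr (- (real_of_int M + \<rho> * real r)))"
    proof (intro mult_mono)
      show "real (card (Z r)) \<le> real Q ^ (2 * r + 2)" using cardZ[of r] by (metis of_nat_le_iff of_nat_power)
      have "real Q powi (- e r) = real Q powr real_of_int (- e r)"
        by (rule powr_real_of_int'[symmetric]) (use \<open>1 < real Q\<close> in auto)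
      also have "\<dots> \<le> real Q powr (- (real_of_int M + \<rho> * real r))"
        using \<open>1 < real Q\<close> le_of_int_ceiling[of "real_of_int M + \<rho> * real r"] unfolding e_def
        by (intro powr_mono) linarith+
      finally show "measure \<mu> (fball (e r)) \<le> measure \<mu> (fball 0) * real Q powr (- (real_of_int M + \<rho> * real r))"
        unfolding measure_fball[OF haar, of "e r"] by (intro mult_left_mono) auto
    qed auto
    also have "\<dots> = c * s ^ r"
    proof -
      have "real Q ^ (2 * r + 2) = real Q ^ 2 * real Q powr (2 * real r)"
        using \<open>1 < real Q\<close> powr_realpow[of "real Q" "2 * r"] by (simp add: power_add power2_eq_square mult.commute)
      moreover have "s ^ r = real Q powr ((2 - \<rho>) * real r)"
        unfolding s_def using \<open>1 < real Q\<close> powr_realpow[of "real Q powr (2 - \<rho>)" r] by (simp add: powr_powr)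
      moreover have "real Q powr (2 * real r) * real Q powr (- (real_of_int M + \<rho> * real r)) =
          real Q powr (- real_of_int M) * real Q powr ((2 - \<rho>) * real r)"
        unfolding powr_add[symmetric] by (rule arg_cong) (simp add: algebra_simps)
      ultimately show ?thesis unfolding c_def by (simp add: mult_ac)
    qed
    finally show ?thesis .
  qed
  have "limsup E \<in> null_sets \<mu>"
  proof (rule borel_cantelli_limsup1)
    show "E r \<in> sets \<mu>" "emeasure \<mu> (E r) < \<infinity>" for r
      using Efm[of r] unfolding fmeasurable_def by auto
    have "summable (\<lambda>r. c * s ^ r)" using s by (intro summable_mult summable_geometric) auto
    then show "summable (\<lambda>r. measure \<mu> (E r))"
      by (rule summable_comparison_test') (use Em in auto)
  qed
  \<comment> \<open>An \<alpha> equal to a fraction may be approximated by that fraction alone, with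
    bounded denominators; such \<alpha> are caught by this countable set.\<close>
  moreover have "Z r \<in> null_sets \<mu>" for r
  proof -
    have "(\<Union>z\<in>Z r. {z}) \<in> null_sets \<mu>"
      by (intro null_sets_UN' singleton_null[OF haar] countable_finite finZ)
    then show ?thesis by simp
  qed
  then have "(\<Union>r. Z r) \<in> null_sets \<mu>" by (rule null_sets_UN)
  ultimately have null: "limsup E \<union> (\<Union>r. Z r) \<in> null_sets \<mu>" by (rule null_sets.Un)
  have "?Phi \<subseteq> limsup E \<union> (\<Union>r. Z r)"
  proof
    fix \<alpha> assume "\<alpha> \<in> ?Phi"
    then have \<alpha>: "absv \<alpha> \<le> 1"
      and ap: "\<And>\<epsilon>. 0 < \<epsilon> \<Longrightarrow> \<exists>f\<in>A. \<exists>g\<in>A - {0}. dist \<alpha> (f / g) < \<epsilon> \<and> dist \<alpha> (f / g) < \<delta> g"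
      unfolding Phi by auto
    have "\<alpha> \<in> limsup E" if not: "\<alpha> \<notin> (\<Union>r. Z r)"
    proof -
      have "\<exists>r\<ge>R. \<alpha> \<in> E r" for R
      proof -
        \<comment> \<open>Apart from \<alpha>, no element of the finite set \<open>Z R\<close> is
          closer to \<alpha> than \<open>d\<close>. A closer fraction therefore has a denominator of
          valuation at most \<open>- R\<close>.\<close>
        obtain d where d: "0 < d" "\<And>z. z \<in> Z R \<Longrightarrow> z \<noteq> \<alpha> \<Longrightarrow> d \<le> dist \<alpha> z"
          using finite_set_avoid[OF finZ[of R], of \<alpha>] by blast
        \<comment> \<open>Distance below 1 keeps \<open>f / g\<close> integral, so the numerator is
          no larger than the denominator and lies in the same \<open>B r\<close>.\<close>
        obtain f g where fg: "f \<in> A" "g \<in> A" "g \<noteq> 0" "dist \<alpha> (f / g) < min d 1" "dist \<alpha> (f / g) < \<delta> g"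
          using ap[of "min d 1"] d(1) by auto
        have "absv (f / g) \<le> 1"
          using v_le_1_trans[OF \<alpha>, of "f / g"] fg(4) unfolding dist_eq by simp
        then have fleg: "absv f \<le> absv g" using fg(3) v_pos[of g] by (simp add: divide_le_eq)
        \<comment> \<open>Discreteness of \<open>A\<close> makes the exponent \<open>r\<close> of
          the denominator a natural number.\<close>
        have "1 \<le> absv g" using A(2)[OF fg(2)] fg(3) by (meson not_le)
        then have "\<nu> g \<le> 0" using absv_nz[OF fg(3)] q_powi_le_iff[of 0 "- \<nu> g"] by simp
        define r where "r = nat (- \<nu> g)"
        have r: "- \<nu> g = int r" using \<open>\<nu> g \<le> 0\<close> unfolding r_def by simp
        have gr: "absv g = real q powi (int r)" using absv_nz[OF fg(3)] r by simp
        have fgB: "f \<in> B r" "g \<in> B r"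
          unfolding B_def fball_def using fg fleg gr by auto
        have "R \<le> r"
        proof (rule ccontr)
          assume "\<not> R \<le> r"
          then have "B r \<subseteq> B R" unfolding B_def using fball_mono[of "- int R" "- int r"] by auto
          then have "f / g \<in> Z R" unfolding Z_def using fgB by force
          moreover have "f / g \<noteq> \<alpha>" using not \<open>f / g \<in> Z R\<close> by blast
          ultimately show False using d(2) fg(4) by fastforce
        qed
        moreover have "\<alpha> \<in> E r"
        proof -
          have fgZ: "f / g \<in> Z r" unfolding Z_def using fgB by force
          have "\<alpha> \<noteq> f / g" using not fgZ by blast
          then have ne: "\<alpha> - f / g \<noteq> 0" by simp
          have Q: "1 < real q" using q by simp
          have "real q powr (real_of_int (- \<nu> (\<alpha> - f / g))) = absv (\<alpha> - f / g)"
            unfolding absv_nz[OF ne] by (rule powr_real_of_int') (use Q in auto)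
          also have "\<dots> < \<delta> g" using fg(5) unfolding dist_eq .
          also have "\<delta> g = real q powr (- real_of_int M) / (real q powr real r) powr \<rho>"
          proof -
            have "absv \<pi> = real q powr (- 1)" using absv_nz[OF pi(1)] pi(2) Q by (simp add: powr_minus power_int_minus)
            moreover have "absv \<pi> powi M = absv \<pi> powr real_of_int M"
              by (rule powr_real_of_int'[symmetric]) (use pi(1) in auto)
            ultimately have "absv \<pi> powi M = real q powr (- real_of_int M)"
              by (simp only: powr_powr) simp
            moreover have "absv g = real q powr real r" unfolding gr using Q by (simp add: powr_realpow)
            ultimately show ?thesis unfolding \<delta>_def by simp
          qed
          also have "\<dots> = real q powr (- (real_of_int M + \<rho> * real r))"
            by (simp add: powr_powr powr_diff[symmetric] mult.commute)
          finally have "real_of_int (- \<nu> (\<alpha> - f / g)) < - (real_of_int M + \<rho> * real r)"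
            using Q by (simp add: powr_less_cancel_iff)
          then have "e r \<le> \<nu> (\<alpha> - f / g)" unfolding e_def by (simp add: ceiling_le_iff)
          then have "\<alpha> - f / g \<in> fball (e r)" by (simp add: mem_fball)
          then have "\<alpha> \<in> cball (f / g) (real q powi (- e r))"
            unfolding fball_def by (simp add: dist_eq v_minus_commute)
          then show ?thesis unfolding E_def using fgZ by blast
        qed
        ultimately show ?thesis by blast
      qed
      then show ?thesis unfolding limsup_INF_SUP by auto
    qed
    then show "\<alpha> \<in> limsup E \<union> (\<Union>r. Z r)" by blast
  qed
  then show ?thesis by (rule null_sets_subset[OF null sets])
qed

end

section \<open>Transfer along the embedding of the function field\<close>

lemma completion_atD:
  assumes "completion_at q P \<iota> \<nu>"
  shows "field_hom \<iota>" "normalized_valuation \<nu>" "dist a b = val_abs q \<nu> (a - b)"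
    "closure (range \<iota>) = UNIV" "P = {f. val_abs q \<nu> (\<iota> f) \<le> 1}"
  using assms unfolding completion_at_def by auto

lemma nonarch_abs_comp:
  assumes "nonarch_abs v" "field_hom \<iota>"
  shows "nonarch_abs (\<lambda>f. v (\<iota> f))"
proof -
  interpret v: nonarch_abs v by fact
  interpret h: field_hom \<iota> by fact
  show ?thesis
  proof
    show "0 < v (\<iota> a)" if "a \<noteq> 0" for a using that v.v_pos[of "\<iota> a"] by simp
    show "v (\<iota> (a * b)) = v (\<iota> a) * v (\<iota> b)" for a b by (simp add: h.hom_mult)
    show "v (\<iota> (a + b)) \<le> max (v (\<iota> a)) (v (\<iota> b))" for a b by (simp add: h.hom_add v.v_add)
  qed simp
qed

theorem theorem1p2:
  fixes F :: "'k::field set" and n :: nat and x :: "nat \<Rightarrow> 'k" and P_inf :: "'k set"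
    and \<iota> :: "'k \<Rightarrow> 'c::{field, complete_space}" and \<nu> :: "'c \<Rightarrow> int" and \<pi> :: 'c
    and \<mu> :: "'c measure" and \<rho> :: real and M :: int
  assumes "finite F"
    and "smooth_projective_curve F n x"
    and "P_inf \<in> closed_points F n x"
    and "completion_at (card F) P_inf \<iota> \<nu>"
    and "\<pi> \<noteq> 0" and "\<nu> \<pi> = 1"
    and "haar_measure \<mu>"
    and "\<rho> > 2"
  shows "Phi_set (card F) (regular_away_from F n x P_inf) \<iota> \<nu> \<pi> M \<rho> \<in> null_sets \<mu>"
proof -
  define q where "q = card F"
  note comp = completion_atD[OF assms(4), folded q_def]
  have F: "type_subring F" using smooth_projective_curveD(1)[OF assms(2)] by (rule type_subfieldD)
  have q: "2 \<le> q"
    using card_mono[OF assms(1), of "{0, 1}"] type_subringD(1,2)[OF F] unfolding q_def by simp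
  interpret h: field_hom \<iota> by (rule comp(1))
  interpret V: nonarch_abs "val_abs q \<nu>" by (rule nonarch_abs_val_abs[OF comp(2) q])
  interpret W: nonarch_abs "\<lambda>f. val_abs q \<nu> (\<iota> f)" by (rule nonarch_abs_comp[OF V.nonarch_abs_axioms comp(1)])
  have dense: "\<exists>f. val_abs q \<nu> (a - \<iota> f) < 1" for a
  proof -
    have "a \<in> closure (range \<iota>)" using comp(4) by simp
    then have "\<forall>e>0. \<exists>y\<in>range \<iota>. dist y a < e" by (simp only: closure_approachable)
    moreover have "0 < (1 :: real)" by simp
    ultimately obtain y where y: "y \<in> range \<iota>" "dist y a < 1"
      by (elim allE[of _ 1] impE bexE)
    then obtain f where "y = \<iota> f" by (elim rangeE)
    then have "val_abs q \<nu> (a - \<iota> f) < 1"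
      using y(2) comp(3)[of y a] V.v_minus_commute[of a y] by simp
    then show ?thesis by (rule exI)
  qed
  have pi_abs: "val_abs q \<nu> \<pi> < 1"
    using assms(5,6) q by (simp add: val_abs_def power_int_minus inverse_less_1_iff)
  \<comment> \<open>Density supplies an element of the function field close to
    \<open>inverse \<pi>\<close>, hence of absolute value above 1; so the valuation is nontrivial
    there.\<close>
  obtain s where s: "s \<noteq> 0" "val_abs q \<nu> (\<iota> s) \<noteq> 1"
  proof -
    obtain f where f: "val_abs q \<nu> (inverse \<pi> - \<iota> f) < 1" using dense by blast
    have "1 < val_abs q \<nu> (inverse \<pi>)" using pi_abs assms(5) by (simp add: one_less_inverse_iff V.v_pos)
    then have "1 < val_abs q \<nu> (\<iota> f)"
      using f V.v_le_1_trans[of "\<iota> f" "inverse \<pi>"] V.v_minus_commute[of "inverse \<pi>" "\<iota> f"] by force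
    then show ?thesis using that[of f] by (cases "f = 0") auto
  qed
  have "W.residue_finite P_inf"
    by (rule W.residue_finite_closed_point[OF assms(1,2) comp(5) assms(3) s])
  then obtain S where S: "finite S" "\<And>f. f \<in> P_inf \<Longrightarrow> \<exists>s\<in>S. val_abs q \<nu> (\<iota> (f - s)) < 1"
    unfolding W.residue_finite_def by blast
  \<comment> \<open>An integral \<open>a\<close> is congruent to some \<open>\<iota> f\<close>, and
    then \<open>f\<close> lies in \<open>P_inf\<close>: completion leaves the residue field
    unchanged.\<close>
  have "V.residue_finite {a. val_abs q \<nu> a \<le> 1}"
    unfolding V.residue_finite_def
  proof (intro exI conjI ballI)
    show "finite (\<iota> ` S)" using S(1) by simp
    fix a assume "a \<in> {a. val_abs q \<nu> a \<le> 1}"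
    then have a: "val_abs q \<nu> a \<le> 1" by simp
    obtain f where f: "val_abs q \<nu> (a - \<iota> f) < 1" using dense by blast
    then have "f \<in> P_inf" using V.v_le_1_trans[OF a] comp(5) by blast
    then obtain t where t: "t \<in> S" "val_abs q \<nu> (\<iota> f - \<iota> t) < 1" using S(2) by (auto simp: h.hom_minus)
    then show "\<exists>t\<in>\<iota> ` S. val_abs q \<nu> (a - t) < 1" using V.v_diff_trans[OF f] by blast
  qed
  then interpret L: local_field q \<nu> \<pi>
    by unfold_locales (use q comp(2,3) assms(5,6) in auto)
  define A where "A = \<iota> ` regular_away_from F n x P_inf"
  have A: "a - b \<in> A" if ab: "a \<in> A" "b \<in> A" for a b
  proof -
    obtain f g where fg: "f \<in> regular_away_from F n x P_inf" "g \<in> regular_away_from F n x P_inf" "a = \<iota> f" "b = \<iota> g"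
      using ab unfolding A_def by blast
    then have "f - g \<in> regular_away_from F n x P_inf"
      using type_subringD(4)[OF regular_away_from_subring[OF F]] by blast
    then show ?thesis unfolding A_def fg(3,4) by (intro image_eqI[of _ _ "f - g"]) (simp_all add: h.hom_minus)
  qed
  have disc: "a = 0" if a: "a \<in> A" "val_abs q \<nu> a < 1" for a
  proof -
    obtain f where "f \<in> regular_away_from F n x P_inf" "a = \<iota> f" using a(1) unfolding A_def by blast
    then show ?thesis using W.regular_away_from_discrete[OF assms(1,2) comp(5)] a(2) by auto
  qed
  \<comment> \<open>Sequences of regular functions correspond to sequences in the image
    \<open>A\<close>; injectivity of \<open>\<iota>\<close> matches the nonzero
    denominators.\<close>
  have "Phi_set q (regular_away_from F n x P_inf) \<iota> \<nu> \<pi> M \<rho> =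
     {\<alpha>. val_abs q \<nu> \<alpha> \<le> 1 \<and> (\<exists>f g. (\<forall>k::nat. f k \<in> A \<and> g k \<in> A \<and> g k \<noteq> 0) \<and>
      (\<lambda>k. f k / g k) \<longlonglongrightarrow> \<alpha> \<and>
      (\<forall>k. val_abs q \<nu> (\<alpha> - f k / g k) < val_abs q \<nu> \<pi> powi M / val_abs q \<nu> (g k) powr \<rho>))}" (is "?l = ?r")
  proof (intro equalityI subsetI)
    fix \<alpha> assume "\<alpha> \<in> ?l"
    then obtain f g where \<alpha>: "val_abs q \<nu> \<alpha> \<le> 1"
      and fg: "\<forall>k::nat. f k \<in> regular_away_from F n x P_inf \<and> g k \<in> regular_away_from F n x P_inf \<and> g k \<noteq> 0"
        "(\<lambda>k. \<iota> (f k) / \<iota> (g k)) \<longlonglongrightarrow> \<alpha>"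
        "\<forall>k. val_abs q \<nu> (\<alpha> - \<iota> (f k) / \<iota> (g k)) < val_abs q \<nu> \<pi> powi M / val_abs q \<nu> (\<iota> (g k)) powr \<rho>"
      unfolding Phi_set_def by blast
    have "\<forall>k. \<iota> (f k) \<in> A \<and> \<iota> (g k) \<in> A \<and> \<iota> (g k) \<noteq> 0" using fg(1) unfolding A_def by simp
    then show "\<alpha> \<in> ?r"
      using \<alpha> fg(2,3) by (intro CollectI conjI exI[of _ "\<lambda>k. \<iota> (f k)"] exI[of _ "\<lambda>k. \<iota> (g k)"])
  next
    fix \<alpha> assume "\<alpha> \<in> ?r"
    then obtain f g where \<alpha>: "val_abs q \<nu> \<alpha> \<le> 1" and fgA: "\<forall>k::nat. f k \<in> A \<and> g k \<in> A \<and> g k \<noteq> 0"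
      and fg: "(\<lambda>k. f k / g k) \<longlonglongrightarrow> \<alpha>"
        "\<forall>k. val_abs q \<nu> (\<alpha> - f k / g k) < val_abs q \<nu> \<pi> powi M / val_abs q \<nu> (g k) powr \<rho>"
      by blast
    obtain f' g' where f': "\<And>k. f k = \<iota> (f' k)" "\<And>k. f' k \<in> regular_away_from F n x P_inf"
      and g': "\<And>k. g k = \<iota> (g' k)" "\<And>k. g' k \<in> regular_away_from F n x P_inf"
      using fgA unfolding A_def image_iff by metis
    have "\<forall>k. f' k \<in> regular_away_from F n x P_inf \<and> g' k \<in> regular_away_from F n x P_inf \<and> g' k \<noteq> 0"
      using f' g' fgA by auto
    then show "\<alpha> \<in> ?l"
      unfolding Phi_set_def using \<alpha> fg[unfolded f'(1) g'(1)]
      by (intro CollectI conjI exI[of _ f'] exI[of _ g'])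
  qed
  also have "\<dots> \<in> null_sets \<mu>"
    by (rule L.well_approximable_null[OF assms(7,8) A disc])
  finally show ?thesis unfolding q_def .
qed

end
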